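(* Let $d\ge 3$. Let $K(\beta)$ be a non-increasing function of $\beta>0$ such that $\mathrm{Var}(N(D))\le K(\beta)\max\{\log^{12}(n),1\}$ for all $n\ge1$, all $\beta>0$ and all $D\in\mathcal{D}_1$. If $f:[0,1]^d\to\mathbb{R}$ is a Lipschitz function with Lipschitz constant $L$, then the linear statistic $X(f)=\sum_{i=1}^nf(X_i)$ satisfies $$\mathrm{Var}(X(f))=O\big(K(\beta)L^2\big)\,n^{\frac{d-2}{d}},$$ that is, there is a constant $C$ depending only on $d$ such that $\mathrm{Var}(X(f))\le C\,K(\beta)\,L^2\,n^{\frac{d-2}{d}}$ for all $n\ge1$.
   Context: Dyadic cubes: for $k\ge 0$, $\mathcal{D}_k$ is the set of all cubes $\prod_{l=1}^d\left[\frac{i_l}{2^k},\frac{i_l+1}{2^k}\right)$ with $0\le i_1,\dots,i_d\le 2^k-1$. For distinct points $x,y\in[0,1)^d$ set $w(x,y)=2^{(d-2)(k-1)}$, where $k$ is the smallest integer such that $x$ and $y$ do not belong to the same cube of $\mathcal{D}_k$. For $\mathbf{x}=(x_1,\dots,x_n)\in([0,1)^d)^n$ let $H_n(\mathbf{x})=\sum_{i\ne j}w(x_i,x_j)$ (sum over ordered pairs). The hierarchical Coulomb gas of size $n$ at inverse temperature $\beta>0$ is the random vector $(X_1,\dots,X_n)$ in $([0,1)^d)^n$ with density $\frac1{Z(n,\beta)}\exp(-\beta H_n(\mathbf{x}))$ with respect to Lebesgue measure, where $Z(n,\beta)$ is the normalizing constant. $N(D)$ denotes the number of indices $i\le n$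 with $X_i\in D$, and $\mathrm{Var}$ is the variance under this measure. Such a function $K(\beta)$, finite for every $\beta>0$, exists (this is the paper's variance bound for dyadic cubes). *)

theory Defs
  imports "HOL-Probability.Probability"
begin

definition half_open_cube :: "(real ^ 'd) set" where
  "half_open_cube = {x. \<forall>l. 0 \<le> x $ l \<and> x $ l < 1}"

definition closed_cube :: "(real ^ 'd) set" where
  "closed_cube = {x. \<forall>l. 0 \<le> x $ l \<and> x $ l \<le> 1}"

definition dyadic_cubes :: "nat \<Rightarrow> (real ^ 'd) set set" where
  "dyadic_cubes k =
     {{x. \<forall>l. real (i l) / 2 ^ k \<le> x $ l \<and> x $ l < (real (i l) + 1) / 2 ^ k} |
        i :: 'd \<Rightarrow> nat. \<forall>l. i l \<le> 2 ^ k - 1}"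

(* For distinct points of the half-open cube the least level is at least 1, because the only
   cube of level 0 is the half-open cube itself; so the truncated subtraction k - 1 is exact.
   The value 0 on the diagonal is a convention: coinciding points form a null set. *)
definition hier_potential :: "real ^ ('d::finite) \<Rightarrow> real ^ 'd \<Rightarrow> real" where
  "hier_potential x y =
     (if x = y then 0
      else let k = (LEAST k. \<not> (\<exists>D \<in> dyadic_cubes k. x \<in> D \<and> y \<in> D))
           in 2 ^ ((CARD('d) - 2) * (k - 1)))"

(* A configuration of n points is given by the values x 0, ..., x (n - 1). *)
definition hier_energy :: "nat \<Rightarrow> (nat \<Rightarrow> real ^ ('d::finite)) \<Rightarrow> real" where
  "hier_energy n x = (\<Sum>i<n. \<Sum>j \<in> {..<n} - {i}. hier_potential (x i) (x j))"

definition config_lebesgue :: "nat \<Rightarrow> (nat \<Rightarrow> real ^ ('d::finite)) measure" where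
  "config_lebesgue n = PiM {..<n} (\<lambda>_. restrict_space lborel half_open_cube)"

definition partition_function :: "'d::finite itself \<Rightarrow> nat \<Rightarrow> real \<Rightarrow> real" where
  "partition_function _ n \<beta> =
     (\<integral>x. exp (- \<beta> * hier_energy n x) \<partial>(config_lebesgue n :: (nat \<Rightarrow> real ^ 'd) measure))"

definition hier_coulomb_gas :: "nat \<Rightarrow> real \<Rightarrow> (nat \<Rightarrow> real ^ ('d::finite)) measure" where
  "hier_coulomb_gas n \<beta> =
     density (config_lebesgue n)
       (\<lambda>x. ennreal (1 / partition_function TYPE('d) n \<beta> * exp (- \<beta> * hier_energy n x)))"

definition point_count :: "nat \<Rightarrow> (real ^ 'd) set \<Rightarrow> (nat \<Rightarrow> real ^ 'd) \<Rightarrow> real" where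
  "point_count n D x = real (card {i. i < n \<and> x i \<in> D})"

definition linear_statistic :: "nat \<Rightarrow> (real ^ 'd \<Rightarrow> real) \<Rightarrow> (nat \<Rightarrow> real ^ 'd) \<Rightarrow> real" where
  "linear_statistic n f x = (\<Sum>i<n. f (x i))"

end

theory Submission
  imports Defs
begin

text \<open>The proof expands the linear statistic along the dyadic tree. Replace \<open>f\<close> by a function that is
constant on the cells of a fine level \<open>M\<close>, give every coarser cell the average of the values of its
\<open>2 ^ d\<close> children, and telescope over the levels. The linear statistic becomes a constant, plus an error
of size \<open>n * L * sqrt d / 2 ^ M\<close>, plus one increment for every cell \<open>i\<close> of every level \<open>k < M\<close>. The
increment of \<open>i\<close> is a linear combination of the numbers of points in the children of \<open>i\<close>; its coefficients
sum to zero and are at most \<open>2 * L * sqrt d / 2 ^ k\<close> in absolute value.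

The increments are pairwise orthogonal under the gas. Exchanging two sibling cells by translation preserves
Lebesgue measure and the level at which any two points separate, hence the energy. The exchange
permutes the children counts of one cell and changes no increment of another cell of the same or a coarser
level. Summing over the children with coefficients of sum zero gives orthogonality
(\<open>increments_orthogonal\<close>).

The second moment of one increment comes from self-similarity. The points inside a cell of level \<open>k\<close> feel
the outside only through an interaction that does not depend on where in the cell they are. So, given which
points are in the cell, they form, after rescaling, a gas of the same kind at inverse temperature
\<open>\<beta> * 2 ^ ((d - 2) * k) \<ge> \<beta>\<close> (\<open>conditional_second_moment\<close>). The assumed variance bound
at this inverse temperature, and the monotonicity of \<open>K\<close>, bound the second moment,
up to a constant that depends on \<open>d\<close>, by \<open>K \<beta> * L\<^sup>2 / 4 ^ k\<close> times the mean of
\<open>max (ln N ^ 12) 1\<close>, where \<open>N\<close> is the number of points in the cell and empty cells contribute nothing (\<open>increment_second_moment\<close>).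

It remains to sum over the cells, which is done for every configuration separately
(\<open>multiscale_sum_le\<close>). The power of the logarithm is at most a constant times \<open>N powr (1 / 6)\<close>. On the
levels with \<open>2 ^ (d * k) \<le> n\<close>, concavity of this power gives a geometric sum that is dominated by its
last term, of order \<open>n powr ((d - 2) / d)\<close>; this is where \<open>d > 2\<close> enters. On the finer levels at most \<open>n\<close> cells are
occupied and the factor \<open>1 / 4 ^ k\<close> makes the sum converge, with the same order.
Letting \<open>M\<close> tend to infinity removes the error (\<open>linear_statistic_variance\<close>).\<close>

section \<open>Dyadic cells and two symmetries of the potential\<close>

text \<open>Dyadic cubes are handled through their integer index vectors: the cell of level \<open>k\<close> that contains
\<open>x\<close> is \<open>2 ^ k * x\<close> rounded down in each coordinate. Parents, rescalings and translations of cubes then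
become integer arithmetic, valid on the whole space and not only on the unit cube.\<close>

definition cell :: "nat \<Rightarrow> real ^ 'd::finite \<Rightarrow> 'd \<Rightarrow> int" where
  "cell k x = (\<lambda>l. \<lfloor>2 ^ k * x $ l\<rfloor>)"

definition grid :: "nat \<Rightarrow> ('d::finite \<Rightarrow> int) set" where
  "grid k = {i. \<forall>l. 0 \<le> i l \<and> i l < 2 ^ k}"

definition parent :: "('d \<Rightarrow> int) \<Rightarrow> 'd \<Rightarrow> int" where
  "parent j = (\<lambda>l. j l div 2)"

lemma cell_coarsen:
  assumes "m \<le> k"
  shows "cell m x l = cell k x l div 2 ^ (k - m)"
proof -
  have "(2::real) ^ k = 2 ^ m * 2 ^ (k - m)"
    using assms by (simp flip: power_add)
  then have "2 ^ m * x $ l = (2 ^ k * x $ l) / real_of_int (2 ^ (k - m))"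
    by simp
  then show ?thesis
    unfolding cell_def by (metis floor_divide_real_eq_div zero_le_numeral zero_le_power)
qed

lemma cell_eq_coarsen: "cell k x = cell k y \<Longrightarrow> m \<le> k \<Longrightarrow> cell m x = cell m y"
  by (rule ext) (simp add: cell_coarsen[of m k])

lemma parent_cell: "parent (cell (Suc k) x) = cell k x"
  by (rule ext) (simp add: parent_def cell_coarsen[of k "Suc k"])

lemma cell_0_iff: "cell 0 x = (\<lambda>_. 0) \<longleftrightarrow> x \<in> half_open_cube"
  by (auto simp: cell_def half_open_cube_def fun_eq_iff floor_eq_iff)

lemma cell_in_grid_iff: "cell k x \<in> grid k \<longleftrightarrow> x \<in> half_open_cube"
proof -
  have "0 \<le> 2 ^ k * x $ l \<longleftrightarrow> 0 \<le> x $ l" for l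
    using zero_le_mult_iff[of "2 ^ k" "x $ l"] by (smt (verit) zero_less_power)
  then show ?thesis
    by (auto simp: cell_def half_open_cube_def grid_def floor_less_iff)
qed

lemma cell_in_grid: "x \<in> half_open_cube \<Longrightarrow> cell k x \<in> grid k"
  by (simp add: cell_in_grid_iff)

lemma finite_grid: "finite (grid k :: ('d::finite \<Rightarrow> int) set)"
proof -
  have "grid k \<subseteq> (\<Pi>\<^sub>E l\<in>(UNIV :: 'd set). {0..<2 ^ k})"
    by (auto simp: grid_def)
  then show ?thesis by (rule finite_subset) (auto intro: finite_PiE)
qed

lemma card_grid: "card (grid k :: ('d::finite \<Rightarrow> int) set) = 2 ^ (k * CARD('d))"
proof -
  have "grid k = (\<Pi>\<^sub>E l\<in>(UNIV :: 'd set). {0..<2 ^ k})"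
    by (auto simp: grid_def)
  then show ?thesis by (simp add: card_PiE power_mult nat_power_eq)
qed

lemma dyadic_cubes_eq: "dyadic_cubes k = (\<lambda>i. {x. cell k x = i}) ` grid k"
proof -
  have box: "{x. cell k x = (\<lambda>l. int (i l))}
      = {x. \<forall>l. real (i l) / 2 ^ k \<le> x $ l \<and> x $ l < (real (i l) + 1) / 2 ^ k}" for i :: "'a \<Rightarrow> nat"
    by (auto simp: cell_def fun_eq_iff floor_eq_iff field_simps)
  have "grid k = (\<lambda>i l. int (i l)) ` {i :: 'a \<Rightarrow> nat. \<forall>l. i l \<le> 2 ^ k - 1}"
  proof (intro equalityI subsetI)
    fix i :: "'a \<Rightarrow> int" assume i: "i \<in> grid k"
    have "nat (i l) \<le> 2 ^ k - 1" for l
    proof -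
      have "nat (i l) < 2 ^ k"
        using i by (auto simp: grid_def nat_less_iff)
      then show ?thesis by linarith
    qed
    moreover have "i = (\<lambda>l. int (nat (i l)))" using i by (auto simp: grid_def)
    ultimately show "i \<in> (\<lambda>i l. int (i l)) ` {i :: 'a \<Rightarrow> nat. \<forall>l. i l \<le> 2 ^ k - 1}"
      by (intro image_eqI[where x = "\<lambda>l. nat (i l)"]) auto
  next
    fix i :: "'a \<Rightarrow> int" assume "i \<in> (\<lambda>i l. int (i l)) ` {i :: 'a \<Rightarrow> nat. \<forall>l. i l \<le> 2 ^ k - 1}"
    then obtain j :: "'a \<Rightarrow> nat" where j: "i = (\<lambda>l. int (j l))" "\<And>l. j l \<le> 2 ^ k - 1" by auto
    have "int (j l) < 2 ^ k" for l
    proof -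
      have "j l < 2 ^ k" using j(2)[of l] by (simp add: le_less_trans)
      then show ?thesis by (metis of_nat_less_iff of_nat_numeral of_nat_power)
    qed
    then show "i \<in> grid k" using j by (auto simp: grid_def)
  qed
  then show ?thesis
    unfolding dyadic_cubes_def by (auto simp: box image_image image_iff)
qed

lemma cells_separate_points:
  assumes "x \<noteq> y"
  shows "\<exists>k. cell k x \<noteq> cell k y"
proof -
  obtain l where l: "x $ l \<noteq> y $ l" using assms by (auto simp: vec_eq_iff)
  obtain k where k: "1 / \<bar>x $ l - y $ l\<bar> < 2 ^ k"
    using real_arch_pow[of 2] by auto
  have "1 < 2 ^ k * \<bar>x $ l - y $ l\<bar>"
    using k l by (simp add: field_simps)
  then have "1 < \<bar>2 ^ k * x $ l - 2 ^ k * y $ l\<bar>"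
    by (simp add: abs_mult right_diff_distrib[symmetric])
  then have "\<lfloor>2 ^ k * x $ l\<rfloor> \<noteq> \<lfloor>2 ^ k * y $ l\<rfloor>" by linarith
  then show ?thesis unfolding cell_def by metis
qed

lemma hier_potential_cell:
  fixes x y :: "real ^ 'd::finite"
  assumes "x \<in> half_open_cube" "y \<in> half_open_cube"
  shows "hier_potential x y = (if x = y then 0 else
     2 ^ ((CARD('d) - 2) * ((LEAST k. cell k x \<noteq> cell k y) - 1)))"
proof -
  have "(\<exists>D \<in> dyadic_cubes k. x \<in> D \<and> y \<in> D) \<longleftrightarrow> cell k x = cell k y" for k
    using cell_in_grid[OF assms(1), of k] by (auto simp: dyadic_cubes_eq)
  then show ?thesis by (simp add: hier_potential_def)
qed

lemma hier_potential_nonneg: "hier_potential x y \<ge> 0"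
  by (simp add: hier_potential_def Let_def)

lemma hier_potential_commute: "hier_potential x y = hier_potential y x"
proof -
  have "(\<exists>D \<in> dyadic_cubes k. x \<in> D \<and> y \<in> D) \<longleftrightarrow> (\<exists>D \<in> dyadic_cubes k. y \<in> D \<and> x \<in> D)" for k
    by blast
  then show ?thesis unfolding hier_potential_def by (simp only: eq_commute[of x y])
qed

text \<open>The potential only sees the first level at which two points separate. If that level moves up by \<open>s\<close>, the
potential is multiplied by \<open>2 ^ ((d - 2) * s)\<close>. The case \<open>s = 0\<close> expresses invariance under maps
that preserve all separation levels.\<close>

lemma hier_potential_rescale:
  fixes x y x' y' :: "real ^ 'd::finite"
  assumes cube: "x \<in> half_open_cube" "y \<in> half_open_cube" "x' \<in> half_open_cube" "y' \<in> half_open_cube"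
  assumes same: "\<And>m. cell (s + m) x' = cell (s + m) y' \<longleftrightarrow> cell m x = cell m y"
  shows "hier_potential x' y' = 2 ^ ((CARD('d) - 2) * s) * hier_potential x y"
proof (cases "x = y")
  case True
  have "cell k x' = cell k y'" for k
    using same[of k] True cell_eq_coarsen[of "s + k" x' y' k] by simp
  then have "x' = y'" using cells_separate_points by blast
  then show ?thesis using True by (simp add: hier_potential_def)
next
  case False
  define k where "k = (LEAST k. cell k x \<noteq> cell k y)"
  have k: "cell k x \<noteq> cell k y"
    unfolding k_def by (rule LeastI_ex[OF cells_separate_points[OF False]])
  have below: "cell m x = cell m y" if "m < k" for m
    using not_less_Least that unfolding k_def by blast
  have "cell 0 x = cell 0 y" using cube by (simp flip: cell_0_iff)
  with k have "k \<noteq> 0" by metis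
  have "(LEAST j. cell j x' \<noteq> cell j y') = s + k"
  proof (rule Least_equality)
    show "cell (s + k) x' \<noteq> cell (s + k) y'" using same k by blast
    fix j assume j: "cell j x' \<noteq> cell j y'"
    show "s + k \<le> j"
    proof (rule ccontr)
      assume "\<not> s + k \<le> j"
      then have "cell (s + (k - 1)) x' = cell (s + (k - 1)) y'" "j \<le> s + (k - 1)"
        using same[of "k - 1"] below[of "k - 1"] \<open>k \<noteq> 0\<close> by auto
      then show False using j cell_eq_coarsen by blast
    qed
  qed
  moreover have "x' \<noteq> y'" using same k by blast
  moreover have "s + k - 1 = s + (k - 1)" using \<open>k \<noteq> 0\<close> by simp
  ultimately show ?thesis
    using False by (simp add: hier_potential_cell cube k_def power_add add_mult_distrib2)
qed

text \<open>From outside a cell its points cannot be told apart: they all separate from an outer point at the same level,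
which is at most \<open>k\<close>. This decouples the positions inside a cell from the rest of the configuration.\<close>

lemma hier_potential_far:
  assumes "x \<in> half_open_cube" "y \<in> half_open_cube" "p \<in> half_open_cube"
  assumes "cell k x = cell k p" "cell k y \<noteq> cell k p"
  shows "hier_potential x y = hier_potential p y"
proof -
  have "cell m x = cell m y \<longleftrightarrow> cell m p = cell m y" for m
  proof (cases "m \<le> k")
    case True
    then show ?thesis using cell_eq_coarsen[OF assms(4)] by simp
  next
    case False
    then show ?thesis using cell_eq_coarsen[of m _ _ k] assms(4,5) by (metis nat_le_linear)
  qed
  then show ?thesis
    using hier_potential_rescale[of p y x y 0] assms by simp
qed

text \<open>The affine bijection from the unit cube onto the cell with index \<open>i\<close>.\<close>

definition into_cell :: "nat \<Rightarrow> ('d \<Rightarrow> int) \<Rightarrow> real ^ 'd::finite \<Rightarrow> real ^ 'd" where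
  "into_cell k i y = (\<chi> l. (of_int (i l) + y $ l) / 2 ^ k)"

lemma cell_into_cell: "cell (k + m) (into_cell k i y) = (\<lambda>l. 2 ^ m * i l + cell m y l)"
proof
  fix l
  have "2 ^ (k + m) * into_cell k i y $ l = of_int (2 ^ m * i l) + 2 ^ m * y $ l"
    by (simp add: into_cell_def power_add field_simps)
  then show "cell (k + m) (into_cell k i y) l = 2 ^ m * i l + cell m y l"
    unfolding cell_def by (simp only: int_add_floor)
qed

lemma cell_into_cell_same:
  assumes "y \<in> half_open_cube"
  shows "cell k (into_cell k i y) = i"
  using cell_into_cell[of k 0 i y] assms by (simp flip: cell_0_iff)

lemma hier_potential_into_cell:
  fixes x y :: "real ^ 'd::finite"
  assumes "x \<in> half_open_cube" "y \<in> half_open_cube" "i \<in> grid k"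
  shows "hier_potential (into_cell k i x) (into_cell k i y) = 2 ^ ((CARD('d) - 2) * k) * hier_potential x y"
proof (rule hier_potential_rescale)
  show "into_cell k i x \<in> half_open_cube" "into_cell k i y \<in> half_open_cube"
    using assms by (simp_all flip: cell_in_grid_iff[of k] add: cell_into_cell_same)
qed (use assms in \<open>auto simp: cell_into_cell fun_eq_iff\<close>)

definition translate :: "nat \<Rightarrow> ('d \<Rightarrow> int) \<Rightarrow> real ^ 'd::finite \<Rightarrow> real ^ 'd" where
  "translate k v x = (\<chi> l. of_int (v l) / 2 ^ k) + x"

text \<open>The exchange of the cells \<open>a\<close> and \<open>b\<close> by translation. It is used for two children of one cell; such an
exchange respects all the cells, coarse and fine.\<close>

definition swap_cells :: "nat \<Rightarrow> ('d \<Rightarrow> int) \<Rightarrow> ('d \<Rightarrow> int) \<Rightarrow> real ^ 'd::finite \<Rightarrow> real ^ 'd" where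
  "swap_cells k a b x =
     (if cell k x = a then translate k (\<lambda>l. b l - a l) x
      else if cell k x = b then translate k (\<lambda>l. a l - b l) x else x)"

lemma cell_translate: "cell (k + m) (translate k v x) = (\<lambda>l. 2 ^ m * v l + cell (k + m) x l)"
proof
  fix l
  have "2 ^ (k + m) * translate k v x $ l = of_int (2 ^ m * v l) + 2 ^ (k + m) * x $ l"
    by (simp add: translate_def power_add field_simps)
  then show "cell (k + m) (translate k v x) l = 2 ^ m * v l + cell (k + m) x l"
    unfolding cell_def by (simp only: int_add_floor)
qed

lemma cell_swap: "cell k (swap_cells k a b x) = Transposition.transpose a b (cell k x)"
proof -
  have "cell k (translate k v x) = (\<lambda>l. v l + cell k x l)" for v
    using cell_translate[of k 0] by simp
  then show ?thesis by (simp add: swap_cells_def Transposition.transpose_def)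
qed

lemma swap_cells_involution: "swap_cells k a b (swap_cells k a b x) = x"
proof -
  have undo_tr: "translate k (\<lambda>l. v l - w l) (translate k (\<lambda>l. w l - v l) x) = x" for v w
    by (simp add: translate_def vec_eq_iff diff_divide_distrib)
  have zero: "translate k (\<lambda>_. 0) y = y" for y
    by (simp add: translate_def vec_eq_iff)
  have "swap_cells k a b (swap_cells k a b x) =
     (if Transposition.transpose a b (cell k x) = a then translate k (\<lambda>l. b l - a l) (swap_cells k a b x)
      else if Transposition.transpose a b (cell k x) = b then translate k (\<lambda>l. a l - b l) (swap_cells k a b x)
      else swap_cells k a b x)"
    by (simp add: swap_cells_def[of k a b "swap_cells k a b x"] cell_swap)
  then show ?thesis
    by (cases "cell k x = a"; cases "cell k x = b")
      (simp_all add: swap_cells_def[of k _ _ x] Transposition.transpose_def undo_tr zero)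
qed

lemma cell_swap_coarse:
  assumes "parent a = parent b" "m < k"
  shows "cell m (swap_cells k a b x) = cell m x"
proof -
  obtain k' where k: "k = Suc k'" using assms(2) by (cases k) auto
  have "parent (cell k (swap_cells k a b x)) = parent (cell k x)"
    using assms(1) by (auto simp: cell_swap Transposition.transpose_def)
  then have "cell k' (swap_cells k a b x) = cell k' x" by (simp add: k parent_cell)
  then show ?thesis using cell_eq_coarsen assms(2) k less_Suc_eq_le by blast
qed

lemma swap_half_open_cube:
  assumes "parent a = parent b" "k > 0"
  shows "swap_cells k a b x \<in> half_open_cube \<longleftrightarrow> x \<in> half_open_cube"
  using cell_swap_coarse[of a b 0 k x] assms by (simp flip: cell_0_iff)

text \<open>Above the level of the exchange nothing changes. From that level on, the cell of a point determines how the
point is translated, so points that share a cell still do so after the exchange; the converse follows because the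
exchange is an involution.\<close>

lemma cell_swap_cong:
  assumes "parent a = parent b"
  shows "cell m (swap_cells k a b x) = cell m (swap_cells k a b y) \<longleftrightarrow> cell m x = cell m y"
proof (cases "m < k")
  case True
  then show ?thesis using cell_swap_coarse[OF assms] by simp
next
  case False
  then obtain j where j: "m = k + j" by (metis le_Suc_ex not_less)
  have *: "cell m (swap_cells k a b x) = cell m (swap_cells k a b y)" if "cell m x = cell m y" for x y
    using that cell_eq_coarsen[OF that, of k] by (simp add: swap_cells_def j cell_translate)
  show ?thesis using *[of x y] *[of "swap_cells k a b x" "swap_cells k a b y"] by (auto simp: swap_cells_involution)
qed

lemma hier_potential_swap:
  assumes "x \<in> half_open_cube" "y \<in> half_open_cube" "parent a = parent b" "k > 0"
  shows "hier_potential (swap_cells k a b x) (swap_cells k a b y) = hier_potential x y"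
  using hier_potential_rescale[of x y "swap_cells k a b x" "swap_cells k a b y" 0] assms
  by (simp add: swap_half_open_cube cell_swap_cong)

section \<open>The unit cube, its configurations and their energy\<close>

definition cube_measure :: "(real ^ 'd::finite) measure" where
  "cube_measure = restrict_space lborel half_open_cube"

lemma cell_measurable [measurable]: "Measurable.pred borel (\<lambda>x. cell k x = j)"
proof -
  have [measurable]: "(\<lambda>x :: real ^ 'a. x $ l) \<in> borel_measurable borel" for l
    by (intro borel_measurable_continuous_onI continuous_intros)
  show ?thesis unfolding cell_def fun_eq_iff by measurable
qed

lemma half_open_cube_measurable [measurable]: "half_open_cube \<in> sets borel"
proof -
  have "half_open_cube = {x \<in> space borel. cell 0 x = (\<lambda>_. 0)}" by (simp add: cell_0_iff)
  also have "\<dots> \<in> sets borel" by measurable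
  finally show ?thesis .
qed

lemma space_cube_measure: "space cube_measure = half_open_cube"
  by (simp add: cube_measure_def space_restrict_space)

lemma measurable_cube_measureI:
  assumes "f \<in> borel_measurable borel" "\<And>x. x \<in> half_open_cube \<Longrightarrow> f x \<in> half_open_cube"
  shows "f \<in> cube_measure \<rightarrow>\<^sub>M cube_measure"
  unfolding cube_measure_def using assms by (intro measurable_restrict_space3) auto

lemma measurable_cube_measure_borel [measurable (raw)]:
  "f \<in> M \<rightarrow>\<^sub>M cube_measure \<Longrightarrow> f \<in> borel_measurable M"
  by (simp add: cube_measure_def measurable_restrict_space2_iff)

lemma emeasure_cube_measure:
  assumes "A \<in> sets borel" "A \<subseteq> half_open_cube"
  shows "emeasure cube_measure A = emeasure lborel A"
  unfolding cube_measure_def using assms by (subst emeasure_restrict_space) auto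

lemma sets_cube_measure_iff: "A \<in> sets cube_measure \<longleftrightarrow> A \<in> sets borel \<and> A \<subseteq> half_open_cube"
  unfolding cube_measure_def by (subst sets_restrict_space_iff) auto

lemma prob_space_cube_measure: "prob_space (cube_measure :: (real ^ 'd::finite) measure)"
proof
  let ?one = "(\<chi> _. 1) :: real ^ 'd"
  have basis: "?one \<bullet> b = 1" if "b \<in> Basis" for b :: "real ^ 'd"
    using that by (auto simp: Basis_vec_def inner_axis)
  have "emeasure lborel (half_open_cube :: (real ^ 'd) set) \<le> emeasure lborel (cbox 0 ?one)"
    by (intro emeasure_mono) (auto simp: half_open_cube_def mem_box_cart less_imp_le)
  moreover have "emeasure lborel (cbox 0 ?one) = 1"
    by (subst emeasure_lborel_cbox) (auto simp: basis)
  moreover have "emeasure lborel (box 0 ?one) \<le> emeasure lborel (half_open_cube :: (real ^ 'd) set)"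
    by (intro emeasure_mono) (auto simp: half_open_cube_def mem_box_cart less_imp_le)
  moreover have "emeasure lborel (box 0 ?one) = 1"
    by (subst emeasure_lborel_box) (auto simp: basis)
  ultimately have "emeasure lborel (half_open_cube :: (real ^ 'd) set) = 1" by simp
  then show "emeasure cube_measure (space (cube_measure :: (real ^ 'd) measure)) = 1"
    by (simp add: space_cube_measure emeasure_cube_measure)
qed

interpretation cube: product_sigma_finite "\<lambda>_. cube_measure :: (real ^ 'd::finite) measure"
  by (intro product_sigma_finite.intro prob_space_imp_sigma_finite prob_space_cube_measure)

abbreviation config :: "nat set \<Rightarrow> (nat \<Rightarrow> real ^ 'd::finite) measure" where
  "config I \<equiv> PiM I (\<lambda>_. cube_measure)"

lemma config_lebesgue_eq: "config_lebesgue n = config {..<n}"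
  by (simp add: config_lebesgue_def cube_measure_def)

lemma config_in_cube: "x \<in> space (config I) \<Longrightarrow> j \<in> I \<Longrightarrow> x j \<in> half_open_cube"
  by (auto simp: space_PiM space_cube_measure)

lemma hier_potential_measurable [measurable (raw)]:
  fixes f g :: "'a \<Rightarrow> real ^ 'd::finite"
  assumes [measurable]: "f \<in> M \<rightarrow>\<^sub>M cube_measure" "g \<in> M \<rightarrow>\<^sub>M cube_measure"
  shows "(\<lambda>x. hier_potential (f x) (g x)) \<in> borel_measurable M"
proof -
  have [measurable]: "(\<lambda>x :: real ^ 'd. x $ l) \<in> borel_measurable borel" for l
    by (intro borel_measurable_continuous_onI continuous_intros)
  have [measurable]: "Measurable.pred M (\<lambda>x. cell k (f x) = cell k (g x))" for k
    unfolding cell_def fun_eq_iff by measurable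
  have eq: "f x = g x \<longleftrightarrow> (\<forall>k. cell k (f x) = cell k (g x))" for x
    using cells_separate_points by metis
  have [measurable]: "Measurable.pred M (\<lambda>x. f x = g x)" unfolding eq by measurable
  have "(\<lambda>x. (if f x = g x then 0 else
     2 ^ ((CARD('d) - 2) * ((LEAST k. cell k (f x) \<noteq> cell k (g x)) - 1))) :: real)
     \<in> borel_measurable M" by measurable
  then show ?thesis
    by (rule measurable_cong[THEN iffD1, rotated])
      (use assms[THEN measurable_space] in \<open>simp add: hier_potential_cell space_cube_measure\<close>)
qed

text \<open>The energy of the points with labels in an arbitrary set, needed because the points that fall into a cell have
arbitrary labels. The diagonal may be included since the potential vanishes on it.\<close>

definition energy :: "nat set \<Rightarrow> (nat \<Rightarrow> real ^ 'd::finite) \<Rightarrow> real" where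
  "energy I x = (\<Sum>i\<in>I. \<Sum>j\<in>I. hier_potential (x i) (x j))"

lemma hier_energy_eq: "hier_energy n x = energy {..<n} x"
proof -
  have "(\<Sum>j\<in>{..<n} - {i}. hier_potential (x i) (x j)) = (\<Sum>j<n. hier_potential (x i) (x j))" for i
    by (intro sum.mono_neutral_left) (auto simp: hier_potential_def)
  then show ?thesis by (simp add: hier_energy_def energy_def)
qed

lemma energy_nonneg: "energy I x \<ge> 0"
  by (simp add: energy_def sum_nonneg hier_potential_nonneg)

lemma energy_measurable [measurable]: "energy I \<in> borel_measurable (config I)"
  unfolding energy_def by measurable

lemma energy_reindex:
  assumes "bij_betw \<pi> I J"
  shows "energy I (\<lambda>i\<in>I. x (\<pi> i)) = energy J x"
proof -
  have "energy I (\<lambda>i\<in>I. x (\<pi> i)) = (\<Sum>i\<in>I. \<Sum>j\<in>I. hier_potential (x (\<pi> i)) (x (\<pi> j)))"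
    by (simp add: energy_def)
  then show ?thesis
    by (simp add: energy_def sum.reindex_bij_betw[OF assms, of "\<lambda>j. hier_potential _ (x j)"]
        sum.reindex_bij_betw[OF assms, of "\<lambda>i. \<Sum>j\<in>J. hier_potential (x i) (x j)"])
qed

text \<open>The preimage of a set splits into the part in \<open>a\<close>, the part in \<open>b\<close> and the rest. Each is
moved by a translation, so Lebesgue measure is preserved.\<close>

lemma distr_swap:
  assumes "parent a = parent b" "k > 0"
  shows "distr cube_measure cube_measure (swap_cells k a b) = (cube_measure :: (real ^ 'd::finite) measure)"
    and "swap_cells k a b \<in> cube_measure \<rightarrow>\<^sub>M (cube_measure :: (real ^ 'd) measure)"
proof -
  have tr [measurable]: "translate k v \<in> borel_measurable borel" for v :: "'d \<Rightarrow> int"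
    unfolding translate_def by measurable
  have [measurable]: "(swap_cells k a b :: real ^ 'd \<Rightarrow> _) \<in> borel_measurable borel"
    unfolding swap_cells_def by measurable
  show meas: "swap_cells k a b \<in> cube_measure \<rightarrow>\<^sub>M (cube_measure :: (real ^ 'd) measure)"
    by (rule measurable_cube_measureI) (use swap_half_open_cube[OF assms] in auto)
  have em_tr: "emeasure lborel (translate k v -` A) = emeasure lborel A"
    if "A \<in> sets borel" for A and v :: "'d \<Rightarrow> int"
  proof -
    have "emeasure lborel A = emeasure (distr lborel borel (translate k v)) A"
      unfolding translate_def by (subst lborel_distr_plus) simp
    then show ?thesis using that by (subst (asm) emeasure_distr) auto
  qed
  show "distr cube_measure cube_measure (swap_cells k a b) = (cube_measure :: (real ^ 'd) measure)"
  proof (rule measure_eqI)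
    fix A assume A': "A \<in> sets (distr cube_measure cube_measure (swap_cells k a b)
      :: (real ^ 'd) measure)"
    then have A [measurable]: "A \<in> sets borel" and sub: "A \<subseteq> half_open_cube"
      by (auto simp: sets_cube_measure_iff)
    define C where "C j = {x :: real ^ 'd. cell k x = j}" for j
    have [measurable]: "C j \<in> sets borel" for j
      using cell_measurable[of k j] unfolding C_def by simp
    have "swap_cells k a b -` A \<inter> space cube_measure = swap_cells k a b -` A"
      using sub swap_half_open_cube[OF assms] by (auto simp: space_cube_measure)
    moreover have "swap_cells k a b -` A \<subseteq> half_open_cube" "swap_cells k a b -` A \<in> sets borel"
      using sub swap_half_open_cube[OF assms] measurable_sets_borel[of "swap_cells k a b" borel A]
      by auto
    ultimately have "emeasure (distr cube_measure cube_measure (swap_cells k a b)) A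
      = emeasure lborel (swap_cells k a b -` A)"
      using A' by (simp add: emeasure_distr[OF meas] emeasure_cube_measure)
    also have "\<dots> = emeasure lborel A"
    proof (cases "a = b")
      case True
      have "swap_cells k a b x = x" for x
        by (simp add: True swap_cells_def translate_def vec_eq_iff)
      then have "swap_cells k a b -` A = A" by (auto simp: vimage_def)
      then show ?thesis by simp
    next
      case False
      let ?u = "translate k (\<lambda>l. b l - a l)" and ?v = "translate k (\<lambda>l. a l - b l)"
      have cu: "cell k (?u x) = b \<longleftrightarrow> cell k x = a" for x
        using cell_translate[of k 0 "\<lambda>l. b l - a l" x] by (auto simp: fun_eq_iff)
      have cv: "cell k (?v x) = a \<longleftrightarrow> cell k x = b" for x
        using cell_translate[of k 0 "\<lambda>l. a l - b l" x] by (auto simp: fun_eq_iff)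
      have [measurable]: "?u -` (A \<inter> C b) \<in> sets borel" "?v -` (A \<inter> C a) \<in> sets borel"
        using measurable_sets_borel[OF tr] by auto
      have "swap_cells k a b -` A = (?u -` (A \<inter> C b) \<union> ?v -` (A \<inter> C a)) \<union> (A - C a - C b)"
        using False by (auto simp: swap_cells_def C_def cu cv split: if_splits)
      then have "emeasure lborel (swap_cells k a b -` A)
        = emeasure lborel (?u -` (A \<inter> C b) \<union> ?v -` (A \<inter> C a)) + emeasure lborel (A - C a - C b)"
        by (simp, subst plus_emeasure) (auto simp: C_def cu cv)
      also have "emeasure lborel (?u -` (A \<inter> C b) \<union> ?v -` (A \<inter> C a))
        = emeasure lborel (?u -` (A \<inter> C b)) + emeasure lborel (?v -` (A \<inter> C a))"
        by (subst plus_emeasure) (use False in \<open>auto simp: C_def cu cv\<close>)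
      also have "\<dots> = emeasure lborel (A \<inter> C b) + emeasure lborel (A \<inter> C a)"
        by (simp add: em_tr del: vimage_Int)
      also have "\<dots> = emeasure lborel ((A \<inter> C b) \<union> (A \<inter> C a))"
        by (subst plus_emeasure) (use False in \<open>auto simp: C_def\<close>)
      also have "\<dots> + emeasure lborel (A - C a - C b) = emeasure lborel (((A \<inter> C b) \<union> (A \<inter> C a)) \<union> (A - C a - C b))"
        by (subst plus_emeasure) auto
      also have "((A \<inter> C b) \<union> (A \<inter> C a)) \<union> (A - C a - C b) = A" by auto
      finally show ?thesis .
    qed
    finally show "emeasure (distr cube_measure cube_measure (swap_cells k a b)) A = emeasure cube_measure A"
      using sub by (simp add: emeasure_cube_measure)
  qed simp
qed

text \<open>Rescaling the unit cube onto a cell turns the uniform law into the uniform law on the cell. The law is written as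
a density with respect to the unit cube so that it can be taken to powers.\<close>

lemma distr_into_cell:
  assumes "i \<in> grid k"
  shows "distr cube_measure cube_measure (into_cell k i) = density (cube_measure :: (real ^ 'd::finite) measure)
      (\<lambda>x. ennreal (2 ^ (k * CARD('d))) * indicator {x. cell k x = i} x)"
    and "into_cell k i \<in> cube_measure \<rightarrow>\<^sub>M (cube_measure :: (real ^ 'd) measure)"
proof -
  define t :: "real ^ 'd" where "t = (\<chi> l. of_int (i l) / 2 ^ k)"
  have affine: "into_cell k i = (\<lambda>y. t + (1 / 2 ^ k) *\<^sub>R y)"
    by (auto simp: into_cell_def t_def vec_eq_iff add_divide_distrib)
  have em [measurable]: "into_cell k i \<in> borel_measurable (borel :: (real ^ 'd) measure)"
    unfolding affine by measurable
  have inv: "cell k (into_cell k i y) = i \<longleftrightarrow> y \<in> half_open_cube" for y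
    unfolding cell_0_iff[symmetric] using cell_into_cell[of k 0 i y] by (simp add: fun_eq_iff)
  show meas: "into_cell k i \<in> cube_measure \<rightarrow>\<^sub>M (cube_measure :: (real ^ 'd) measure)"
  proof (rule measurable_cube_measureI[OF em])
    show "into_cell k i x \<in> half_open_cube" if "x \<in> half_open_cube" for x
      using cell_in_grid_iff[of k "into_cell k i x"] inv[of x] assms that by metis
  qed
  show "distr cube_measure cube_measure (into_cell k i) = density (cube_measure :: (real ^ 'd::finite) measure)
      (\<lambda>x. ennreal (2 ^ (k * CARD('d))) * indicator {x. cell k x = i} x)"
    (is "_ = density _ ?g")
  proof (rule measure_eqI)
    fix A assume A': "A \<in> sets (distr cube_measure cube_measure (into_cell k i)
      :: (real ^ 'd) measure)"
    then have A [measurable]: "A \<in> sets borel" and sub: "A \<subseteq> half_open_cube"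
      by (auto simp: sets_cube_measure_iff)
    define B where "B = A \<inter> {x. cell k x = i}"
    have B [measurable]: "B \<in> sets borel"
      using cell_measurable[of k i] unfolding B_def by simp
    have "emeasure lborel B = emeasure (density (distr lborel borel (into_cell k i)) (\<lambda>_. ennreal (\<bar>1 / 2 ^ k\<bar> ^ DIM(real ^ 'd)))) B"
      unfolding affine by (subst lborel_affine[of "1 / 2 ^ k" t, symmetric]) auto
    also have "\<dots> = ennreal (1 / 2 ^ (k * CARD('d))) * emeasure lborel (into_cell k i -` B)"
      by (subst emeasure_density_const)
        (auto simp: emeasure_distr power_divide power_mult)
    finally have "ennreal (2 ^ (k * CARD('d))) * emeasure lborel B
      = ennreal (2 ^ (k * CARD('d))) * ennreal (1 / 2 ^ (k * CARD('d))) * emeasure lborel (into_cell k i -` B)"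
      by (simp add: mult.assoc)
    also have "ennreal (2 ^ (k * CARD('d))) * ennreal (1 / 2 ^ (k * CARD('d))) = 1"
      by (simp flip: ennreal_mult' ennreal_1 del: ennreal_1)
    finally have scale: "ennreal (2 ^ (k * CARD('d))) * emeasure lborel B = emeasure lborel (into_cell k i -` B)"
      by simp
    have "emeasure (density cube_measure ?g) A = (\<integral>\<^sup>+x. ennreal (2 ^ (k * CARD('d))) * indicator B x \<partial>cube_measure)"
      using A' by (subst emeasure_density)
        (auto simp: B_def cube_measure_def indicator_def intro!: nn_integral_cong measurable_restrict_space1)
    also have "\<dots> = ennreal (2 ^ (k * CARD('d))) * emeasure cube_measure B"
      by (intro nn_integral_cmult_indicator) (use sub in \<open>auto simp: sets_cube_measure_iff B_def[symmetric], auto simp: B_def\<close>)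
    also have "\<dots> = emeasure lborel (into_cell k i -` B)"
      using sub scale by (subst emeasure_cube_measure) (auto, auto simp: B_def)
    also have "into_cell k i -` B = into_cell k i -` A \<inter> space cube_measure"
      by (auto simp: B_def inv space_cube_measure)
    also have "emeasure lborel \<dots> = emeasure (distr cube_measure cube_measure (into_cell k i)) A"
      using A' measurable_sets[OF meas, of A]
      by (subst emeasure_distr[OF meas]) (auto simp: emeasure_cube_measure sets_cube_measure_iff)
    finally show "emeasure (distr cube_measure cube_measure (into_cell k i)) A
       = emeasure (density cube_measure ?g) A" by simp
  qed simp
qed

text \<open>Both symmetries act on every point of a configuration separately. This transfers their effect on one point to
configurations: the exchange of siblings is the case \<open>g = 1\<close>, the rescaling into a cell the case
of a multiple of its indicator.\<close>

lemma distr_config_density: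
  fixes g :: "real ^ 'd::finite \<Rightarrow> ennreal"
  assumes I: "finite I" and [measurable]: "T \<in> cube_measure \<rightarrow>\<^sub>M cube_measure" "g \<in> borel_measurable cube_measure"
  assumes T: "distr cube_measure cube_measure T = density cube_measure g"
  shows "distr (config I) (config I) (compose I T) = density (config I) (\<lambda>x. \<Prod>i\<in>I. g (x i))"
proof -
  let ?D = "density cube_measure g"
  have prob: "prob_space ?D"
    unfolding T[symmetric] by (rule prob_space.prob_space_distr[OF prob_space_cube_measure assms(2)])
  interpret D: product_sigma_finite "\<lambda>_. ?D"
    by (intro product_sigma_finite.intro prob_space_imp_sigma_finite prob)
  have "distr (config I) (config I) (compose I T) = PiM I (\<lambda>_. ?D)"
    by (subst distr_PiM_finite_prob_space') (auto simp: I T prob_space_cube_measure)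
  also have "\<dots> = density (config I) (\<lambda>x. \<Prod>i\<in>I. g (x i))"
  proof (rule D.PiM_eqI[symmetric, OF I])
    show "sets (density (config I) (\<lambda>x. \<Prod>i\<in>I. g (x i))) = sets (PiM I (\<lambda>_. ?D))"
      by (simp, intro sets_PiM_cong) auto
    fix A assume A: "\<And>i. i \<in> I \<Longrightarrow> A i \<in> sets ?D"
    then have [measurable]: "i \<in> I \<Longrightarrow> A i \<in> sets cube_measure" for i by simp
    have "emeasure (density (config I) (\<lambda>x. \<Prod>i\<in>I. g (x i))) (Pi\<^sub>E I A)
      = (\<integral>\<^sup>+x. (\<Prod>i\<in>I. g (x i)) * indicator (Pi\<^sub>E I A) x \<partial>config I)"
      by (intro emeasure_density) (auto intro!: sets_PiM_I_finite I A[simplified])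
    also have "\<dots> = (\<integral>\<^sup>+x. (\<Prod>i\<in>I. g (x i) * indicator (A i) (x i)) \<partial>config I)"
    proof (rule nn_integral_cong)
      fix x :: "nat \<Rightarrow> real ^ 'd" assume "x \<in> space (config I)"
      then have "indicator (Pi\<^sub>E I A) x = (\<Prod>i\<in>I. indicator (A i) (x i) :: ennreal)"
        using I by (auto simp: indicator_def space_PiM PiE_def Pi_def prod_zero_iff)
      then show "(\<Prod>i\<in>I. g (x i)) * indicator (Pi\<^sub>E I A) x = (\<Prod>i\<in>I. g (x i) * indicator (A i) (x i))"
        by (simp add: prod.distrib)
    qed
    also have "\<dots> = (\<Prod>i\<in>I. \<integral>\<^sup>+x. g x * indicator (A i) x \<partial>cube_measure)"
      by (intro cube.product_nn_integral_prod I) auto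
    also have "\<dots> = (\<Prod>i\<in>I. emeasure ?D (A i))"
      by (intro prod.cong refl emeasure_density[symmetric]) auto
    finally show "emeasure (density (config I) (\<lambda>x. \<Prod>i\<in>I. g (x i))) (Pi\<^sub>E I A) = (\<Prod>i\<in>I. emeasure ?D (A i))" .
  qed
  finally show ?thesis .
qed

lemma compose_measurable:
  "T \<in> cube_measure \<rightarrow>\<^sub>M cube_measure \<Longrightarrow> compose I T \<in> config I \<rightarrow>\<^sub>M config I"
  unfolding compose_def by (intro measurable_restrict) simp

section \<open>The Gibbs measure and its conditional law inside a cell\<close>

abbreviation gibbs_weight :: "real \<Rightarrow> nat set \<Rightarrow> (nat \<Rightarrow> real ^ 'd::finite) \<Rightarrow> ennreal" where
  "gibbs_weight \<beta> I x \<equiv> ennreal (exp (- (\<beta> * energy I x)))"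

lemma prob_space_config: "prob_space (config I)"
  by (intro prob_space_PiM prob_space_cube_measure)

lemma partition_function_pos:
  assumes "\<beta> > 0"
  shows "partition_function TYPE('d::finite) n \<beta> > 0"
    and "(\<integral>\<^sup>+x. gibbs_weight \<beta> {..<n} x \<partial>(config {..<n} :: (nat \<Rightarrow> real ^ 'd) measure))
           = ennreal (partition_function TYPE('d) n \<beta>)"
proof -
  let ?M = "config {..<n} :: (nat \<Rightarrow> real ^ 'd) measure"
  interpret M: prob_space ?M by (rule prob_space_config)
  have int: "integrable ?M (\<lambda>x. exp (- (\<beta> * energy {..<n} x)))"
    by (rule M.integrable_const_bound[where B = 1])
      (use assms in \<open>auto intro!: AE_I2 mult_nonneg_nonneg energy_nonneg\<close>)
  have Z: "partition_function TYPE('d) n \<beta> = (\<integral>x. exp (- (\<beta> * energy {..<n} x)) \<partial>?M)"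
    by (simp add: partition_function_def config_lebesgue_eq hier_energy_eq)
  show nn: "(\<integral>\<^sup>+x. gibbs_weight \<beta> {..<n} x \<partial>?M) = ennreal (partition_function TYPE('d) n \<beta>)"
    unfolding Z by (rule nn_integral_eq_integral[OF int]) simp
  have "(\<integral>\<^sup>+x. gibbs_weight \<beta> {..<n} x \<partial>?M) \<noteq> 0"
    by (subst nn_integral_0_iff_AE) auto
  then have "partition_function TYPE('d) n \<beta> \<noteq> 0" using nn by auto
  moreover have "partition_function TYPE('d) n \<beta> \<ge> 0"
    unfolding Z by (rule Bochner_Integration.integral_nonneg) simp
  ultimately show "partition_function TYPE('d) n \<beta> > 0" by linarith
qed

lemma gas_eq_density:
  assumes "\<beta> > 0"
  shows "hier_coulomb_gas n \<beta> = density (config {..<n} :: (nat \<Rightarrow> real ^ 'd::finite) measure)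
     (\<lambda>x. ennreal (1 / partition_function TYPE('d) n \<beta>) * gibbs_weight \<beta> {..<n} x)"
proof -
  have "ennreal (1 / partition_function TYPE('d) n \<beta> * exp (- (\<beta> * energy {..<n} x)))
    = ennreal (1 / partition_function TYPE('d) n \<beta>) * gibbs_weight \<beta> {..<n} x"
    for x :: "nat \<Rightarrow> real ^ 'd"
    using partition_function_pos(1)[OF assms, where 'd='d, of n] by (intro ennreal_mult) auto
  then show ?thesis
    by (simp add: hier_coulomb_gas_def config_lebesgue_eq hier_energy_eq)
qed

lemma sets_gas [measurable_cong]: "sets (hier_coulomb_gas n \<beta>) = sets (config {..<n})"
  by (simp add: hier_coulomb_gas_def config_lebesgue_eq)

lemma space_gas: "space (hier_coulomb_gas n \<beta>) = space (config {..<n})"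
  by (simp add: hier_coulomb_gas_def config_lebesgue_eq)

lemma nn_integral_gas:
  fixes f :: "(nat \<Rightarrow> real ^ 'd::finite) \<Rightarrow> ennreal"
  assumes "\<beta> > 0" and [measurable]: "f \<in> borel_measurable (config {..<n})"
  shows "(\<integral>\<^sup>+x. f x \<partial>hier_coulomb_gas n \<beta>)
     = ennreal (1 / partition_function TYPE('d) n \<beta>) * (\<integral>\<^sup>+x. f x * gibbs_weight \<beta> {..<n} x \<partial>config {..<n})"
  unfolding gas_eq_density[OF assms(1)]
  by (subst nn_integral_density, measurable, subst nn_integral_cmult[symmetric], measurable)
    (simp add: mult_ac)

lemma prob_space_gas:
  assumes "\<beta> > 0"
  shows "prob_space (hier_coulomb_gas n \<beta> :: (nat \<Rightarrow> real ^ 'd::finite) measure)"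
proof
  have "emeasure (hier_coulomb_gas n \<beta>) (space (hier_coulomb_gas n \<beta>) :: (nat \<Rightarrow> real ^ 'd) set)
      = (\<integral>\<^sup>+x. 1 \<partial>(hier_coulomb_gas n \<beta> :: (nat \<Rightarrow> real ^ 'd) measure))"
    by simp
  also have "\<dots> = ennreal (1 / partition_function TYPE('d) n \<beta>) * ennreal (partition_function TYPE('d) n \<beta>)"
    by (subst nn_integral_gas[OF assms]) (auto simp: partition_function_pos(2)[OF assms] simp del: nn_integral_const)
  also have "\<dots> = 1"
    using partition_function_pos(1)[OF assms, where 'd='d, of n] by (simp flip: ennreal_mult)
  finally show "emeasure (hier_coulomb_gas n \<beta>) (space (hier_coulomb_gas n \<beta>) :: (nat \<Rightarrow> real ^ 'd) set) = 1" .
qed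

text \<open>Exchanging siblings preserves the reference measure and the energy, hence the Gibbs measure.\<close>

lemma gas_swap_invariant:
  fixes G :: "(nat \<Rightarrow> real ^ 'd::finite) \<Rightarrow> real"
  assumes "\<beta> > 0" "parent a = parent b" "k > 0" and [measurable]: "G \<in> borel_measurable (config {..<n})"
  shows "(\<integral>x. G (compose {..<n} (swap_cells k a b) x) \<partial>hier_coulomb_gas n \<beta>) = (\<integral>x. G x \<partial>hier_coulomb_gas n \<beta>)"
proof -
  let ?M = "config {..<n} :: (nat \<Rightarrow> real ^ 'd) measure" and ?T = "compose {..<n} (swap_cells k a b)"
  have [measurable]: "?T \<in> ?M \<rightarrow>\<^sub>M ?M"
    by (intro compose_measurable distr_swap assms)
  let ?w = "\<lambda>x :: nat \<Rightarrow> real ^ 'd. ennreal (1 / partition_function TYPE('d) n \<beta>) * gibbs_weight \<beta> {..<n} x"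
  have "distr ?M ?M ?T = density ?M (\<lambda>x. \<Prod>i<n. 1)"
    by (rule distr_config_density[where g = "\<lambda>_. 1"])
      (use distr_swap[OF assms(2,3)] in \<open>auto simp: density_1\<close>)
  then have T: "distr ?M ?M ?T = ?M" by (simp add: density_1)
  have "hier_coulomb_gas n \<beta> = density (distr ?M ?M ?T) ?w"
    by (simp add: T gas_eq_density[OF assms(1)])
  also have "\<dots> = distr (density ?M (\<lambda>x. ?w (?T x))) ?M ?T"
    by (rule density_distr) measurable
  also have "density ?M (\<lambda>x. ?w (?T x)) = density ?M ?w"
  proof (rule density_cong)
    have "energy {..<n} (?T x) = energy {..<n} x" if "x \<in> space ?M" for x
      using config_in_cube[OF that] assms by (simp add: energy_def compose_def hier_potential_swap)
    then show "AE x in ?M. ?w (?T x) = ?w x" by (intro AE_I2) simp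
  qed measurable
  also have "\<dots> = hier_coulomb_gas n \<beta>" by (rule gas_eq_density[OF assms(1), symmetric])
  finally have inv: "hier_coulomb_gas n \<beta> = distr (hier_coulomb_gas n \<beta>) ?M ?T" .
  show ?thesis
    by (subst (2) inv, subst integral_distr) measurable
qed

lemma energy_Un:
  assumes "finite R" "finite S" "R \<inter> S = {}"
  shows "energy (R \<union> S) x = energy R x + energy S x + 2 * (\<Sum>i\<in>S. \<Sum>j\<in>R. hier_potential (x i) (x j))"
proof -
  have "(\<Sum>i\<in>R. \<Sum>j\<in>S. hier_potential (x i) (x j)) = (\<Sum>i\<in>S. \<Sum>j\<in>R. hier_potential (x i) (x j))"
    by (subst sum.swap) (simp only: hier_potential_commute)
  then show ?thesis
    by (simp add: energy_def sum.union_disjoint[OF assms] sum.distrib)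
qed

lemma nn_integral_config_reindex:
  assumes \<pi>: "bij_betw \<pi> S J" and [measurable]: "h \<in> borel_measurable (config S)"
  shows "(\<integral>\<^sup>+x. h x \<partial>config S) = (\<integral>\<^sup>+x. h (\<lambda>i\<in>S. x (\<pi> i)) \<partial>config J)"
proof -
  have [measurable]: "(\<lambda>x. \<lambda>i\<in>S. x (\<pi> i)) \<in> config J \<rightarrow>\<^sub>M config S"
    using \<pi> by (intro measurable_restrict measurable_component_singleton) (auto simp: bij_betw_def)
  have "distr (config J) (config S) (\<lambda>x. \<lambda>i\<in>S. x (\<pi> i)) = config S"
    using \<pi> by (intro distr_PiM_reindex prob_space_cube_measure) (auto simp: bij_betw_def)
  then have "(\<integral>\<^sup>+x. h x \<partial>config S) = (\<integral>\<^sup>+x. h x \<partial>distr (config J) (config S) (\<lambda>x. \<lambda>i\<in>S. x (\<pi> i)))"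
    by (rule arg_cong[OF sym])
  also have "\<dots> = (\<integral>\<^sup>+x. h (\<lambda>i\<in>S. x (\<pi> i)) \<partial>config J)"
    by (rule nn_integral_distr) measurable
  finally show ?thesis .
qed

lemma cell_indicator_measurable [measurable]:
  "(indicator {x. cell k x = i} :: _ \<Rightarrow> ennreal) \<in> borel_measurable cube_measure"
  unfolding cube_measure_def
  by (intro measurable_restrict_space1 borel_measurable_indicator) (use cell_measurable in simp)

text \<open>Change of variables for configurations that lie entirely in one cell.\<close>

lemma nn_integral_config_in_cell:
  fixes h :: "(nat \<Rightarrow> real ^ 'd::finite) \<Rightarrow> ennreal"
  assumes S: "finite S" and i: "i \<in> grid k" and [measurable]: "h \<in> borel_measurable (config S)"
  shows "(\<integral>\<^sup>+x. (\<Prod>j\<in>S. indicator {x. cell k x = i} (x j)) * h x \<partial>config S)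
    = ennreal (1 / 2 ^ (k * CARD('d) * card S)) * (\<integral>\<^sup>+x. h (compose S (into_cell k i) x) \<partial>config S)"
proof -
  let ?V = "2 ^ (k * CARD('d)) :: real" and ?ind = "indicator {x. cell k x = i} :: real ^ 'd \<Rightarrow> ennreal"
  note [measurable] = compose_measurable[OF distr_into_cell(2)[OF i], of S]
  have D: "distr (config S) (config S) (compose S (into_cell k i)) = density (config S) (\<lambda>x. \<Prod>j\<in>S. ennreal ?V * ?ind (x j))"
    by (rule distr_config_density[OF S distr_into_cell(2)[OF i] _ distr_into_cell(1)[OF i]]) measurable
  have "ennreal (1 / 2 ^ (k * CARD('d) * card S)) * ennreal ?V ^ card S = 1"
    by (simp add: ennreal_power power_mult flip: ennreal_mult)
  \<comment> \<open>multiplying and dividing by the inverse volume of the cells produces the density of the rescaled law\<close>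
  then have V: "(\<Prod>j\<in>S. ?ind (x j)) * h x
    = ennreal (1 / 2 ^ (k * CARD('d) * card S)) * ((\<Prod>j\<in>S. ennreal ?V * ?ind (x j)) * h x)" for x
    by (simp add: prod.distrib mult.assoc[symmetric])
  have "(\<integral>\<^sup>+x. h (compose S (into_cell k i) x) \<partial>config S)
      = (\<integral>\<^sup>+x. h x \<partial>distr (config S) (config S) (compose S (into_cell k i)))"
    by (rule nn_integral_distr[symmetric]) measurable
  also have "\<dots> = (\<integral>\<^sup>+x. (\<Prod>j\<in>S. ennreal ?V * ?ind (x j)) * h x \<partial>config S)"
    unfolding D by (rule nn_integral_density) measurable
  finally show ?thesis
    unfolding V by (subst nn_integral_cmult) measurable
qed

text \<open>The self-similarity of the gas. The points with labels in \<open>S\<close>, confined to the cell \<open>i\<close> and weighted by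
their own energy only, form a rescaled gas of \<open>card S\<close> points whose inverse temperature is multiplied by
\<open>2 ^ ((d - 2) * k)\<close>. Stated without normalisation, so that it can be integrated against the outer points.\<close>

lemma block_bound:
  fixes \<phi> :: "real ^ 'd::finite \<Rightarrow> real"
  assumes \<beta>: "\<beta> > 0" and i: "i \<in> grid k" and S: "finite S"
    and [measurable]: "\<phi> \<in> borel_measurable cube_measure"
    and bound: "(\<integral>\<^sup>+x. ennreal ((\<Sum>j<card S. \<phi> (into_cell k i (x j)))\<^sup>2)
          \<partial>hier_coulomb_gas (card S) (\<beta> * 2 ^ ((CARD('d) - 2) * k))) \<le> ennreal b"
  shows "(\<integral>\<^sup>+x. (\<Prod>j\<in>S. indicator {x. cell k x = i} (x j)) *
              (ennreal ((\<Sum>j\<in>S. \<phi> (x j))\<^sup>2) * gibbs_weight \<beta> S x) \<partial>config S)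
       \<le> ennreal b * (\<integral>\<^sup>+x. (\<Prod>j\<in>S. indicator {x. cell k x = i} (x j)) * gibbs_weight \<beta> S x \<partial>config S)"
proof -
  define m where "m = card S"
  define \<beta>' where "\<beta>' = \<beta> * 2 ^ ((CARD('d) - 2) * k)"
  have \<beta>': "\<beta>' > 0" using \<beta> by (simp add: \<beta>'_def)
  let ?E = "compose S (into_cell k i)" and ?Z = "partition_function TYPE('d) m \<beta>'"
  note [measurable] = distr_into_cell(2)[OF i]
  obtain \<pi> where \<pi>: "bij_betw \<pi> S {..<m}"
    using ex_bij_betw_finite_nat[OF S] by (auto simp: m_def atLeast0LessThan)
  have W: "gibbs_weight \<beta> S (?E x) = gibbs_weight \<beta>' S x" if "x \<in> space (config S)" for x
  proof -
    have "energy S (?E x) = 2 ^ ((CARD('d) - 2) * k) * energy S x"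
      using config_in_cube[OF that] i
      by (simp add: energy_def compose_def hier_potential_into_cell sum_distrib_left)
    then show ?thesis by (simp add: \<beta>'_def)
  qed
  have pull: "(\<integral>\<^sup>+x. (\<Prod>j\<in>S. indicator {x. cell k x = i} (x j)) * (f (\<Sum>j\<in>S. \<phi> (x j)) * gibbs_weight \<beta> S x) \<partial>config S)
     = ennreal (1 / 2 ^ (k * CARD('d) * m)) *
        (\<integral>\<^sup>+x. f (\<Sum>j<m. \<phi> (into_cell k i (x j))) * gibbs_weight \<beta>' {..<m} x \<partial>config {..<m})"
    if [measurable]: "f \<in> borel_measurable borel" for f
  proof -
    have "(\<integral>\<^sup>+x. (\<Prod>j\<in>S. indicator {x. cell k x = i} (x j)) * (f (\<Sum>j\<in>S. \<phi> (x j)) * gibbs_weight \<beta> S x) \<partial>config S)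
      = ennreal (1 / 2 ^ (k * CARD('d) * m)) *
        (\<integral>\<^sup>+x. f (\<Sum>j\<in>S. \<phi> (?E x j)) * gibbs_weight \<beta> S (?E x) \<partial>config S)"
      unfolding m_def by (rule nn_integral_config_in_cell[OF S i]) measurable
    also have "(\<integral>\<^sup>+x. f (\<Sum>j\<in>S. \<phi> (?E x j)) * gibbs_weight \<beta> S (?E x) \<partial>config S)
      = (\<integral>\<^sup>+x. f (\<Sum>j\<in>S. \<phi> (into_cell k i (x j))) * gibbs_weight \<beta>' S x \<partial>config S)"
      by (intro nn_integral_cong) (simp only: W, simp add: compose_def)
    also have "\<dots> = (\<integral>\<^sup>+x. f (\<Sum>j<m. \<phi> (into_cell k i (x j))) * gibbs_weight \<beta>' {..<m} x \<partial>config {..<m})"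
      by (subst nn_integral_config_reindex[OF \<pi>], measurable)
        (simp add: energy_reindex[OF \<pi>] sum.reindex_bij_betw[OF \<pi>, of "\<lambda>j. \<phi> (into_cell k i (_ j))"])
    finally show ?thesis .
  qed
  have "(\<integral>\<^sup>+x. ennreal ((\<Sum>j<m. \<phi> (into_cell k i (x j)))\<^sup>2) * gibbs_weight \<beta>' {..<m} x \<partial>config {..<m})
      = ennreal ?Z * (ennreal (1 / ?Z) * (\<integral>\<^sup>+x. ennreal ((\<Sum>j<m. \<phi> (into_cell k i (x j)))\<^sup>2) * gibbs_weight \<beta>' {..<m} x \<partial>config {..<m}))"
    using partition_function_pos(1)[OF \<beta>', where 'd='d, of m]
    by (simp add: mult.assoc[symmetric] flip: ennreal_mult)
  also have "\<dots> = ennreal ?Z * (\<integral>\<^sup>+x. ennreal ((\<Sum>j<m. \<phi> (into_cell k i (x j)))\<^sup>2) \<partial>hier_coulomb_gas m \<beta>')"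
    by (subst nn_integral_gas[OF \<beta>']) measurable
  also have "\<dots> \<le> ennreal ?Z * ennreal b"
    using bound by (intro mult_left_mono) (auto simp: m_def \<beta>'_def)
  also have "\<dots> = ennreal b * (\<integral>\<^sup>+x. gibbs_weight \<beta>' {..<m} x \<partial>(config {..<m} :: (nat \<Rightarrow> real ^ 'd) measure))"
    by (simp add: partition_function_pos(2)[OF \<beta>'] mult.commute)
  finally have "(\<integral>\<^sup>+x. ennreal ((\<Sum>j<m. \<phi> (into_cell k i (x j)))\<^sup>2) * gibbs_weight \<beta>' {..<m} x \<partial>config {..<m})
    \<le> ennreal b * (\<integral>\<^sup>+x. gibbs_weight \<beta>' {..<m} x \<partial>(config {..<m} :: (nat \<Rightarrow> real ^ 'd) measure))" .
  then have "ennreal (1 / 2 ^ (k * CARD('d) * m)) * (\<integral>\<^sup>+x. ennreal ((\<Sum>j<m. \<phi> (into_cell k i (x j)))\<^sup>2) * gibbs_weight \<beta>' {..<m} x \<partial>config {..<m})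
    \<le> ennreal b * (ennreal (1 / 2 ^ (k * CARD('d) * m)) * (\<integral>\<^sup>+x. gibbs_weight \<beta>' {..<m} x \<partial>(config {..<m} :: (nat \<Rightarrow> real ^ 'd) measure)))"
    by (subst mult.left_commute) (intro mult_left_mono, auto)
  then show ?thesis
    using pull[of "\<lambda>s. ennreal (s\<^sup>2)"] pull[of "\<lambda>_. 1"] by simp
qed

definition count_in :: "nat \<Rightarrow> nat \<Rightarrow> ('d \<Rightarrow> int) \<Rightarrow> (nat \<Rightarrow> real ^ 'd::finite) \<Rightarrow> nat" where
  "count_in n k i x = card {j. j < n \<and> cell k (x j) = i}"

text \<open>A bound on a second moment for the rescaled gases of all sizes passes to the points of the cell \<open>i\<close> in the
full gas. The space of configurations is split according to the set \<open>S\<close> of labels of the points in the cell. On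
each piece the weight factors into one part for the inner points and another for the outer ones, because the
interaction between them does not depend on the inner positions; then \<open>block_bound\<close> is applied to the
inner integral.\<close>

lemma conditional_second_moment:
  fixes \<phi> :: "real ^ 'd::finite \<Rightarrow> real"
  assumes \<beta>: "\<beta> > 0" and i: "i \<in> grid k"
    and [measurable]: "\<phi> \<in> borel_measurable cube_measure"
    and bound: "\<And>m. m \<le> n \<Longrightarrow> (\<integral>\<^sup>+x. ennreal ((\<Sum>j<m. \<phi> (into_cell k i (x j)))\<^sup>2)
          \<partial>hier_coulomb_gas m (\<beta> * 2 ^ ((CARD('d) - 2) * k))) \<le> ennreal (b m)"
  shows "(\<integral>\<^sup>+x. ennreal ((\<Sum>j<n. if cell k (x j) = i then \<phi> (x j) else 0)\<^sup>2) \<partial>hier_coulomb_gas n \<beta>)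
       \<le> (\<integral>\<^sup>+x. ennreal (b (count_in n k i x)) \<partial>hier_coulomb_gas n \<beta>)"
proof -
  let ?M = "config {..<n} :: (nat \<Rightarrow> real ^ 'd) measure" and ?D = "{x :: real ^ 'd. cell k x = i}"
  have cellpred [measurable]: "Measurable.pred ?M (\<lambda>x. cell k (x j) = i)" if [measurable]: "j \<in> {..<n}" for j
  proof -
    have [measurable]: "(\<lambda>x. x j) \<in> ?M \<rightarrow>\<^sub>M cube_measure"
      using that by (rule measurable_component_singleton)
    show ?thesis by (rule measurable_compose[OF measurable_cube_measure_borel cell_measurable]) measurable
  qed
  have point: "(\<lambda>x. \<phi> (x j)) \<in> borel_measurable ?M" if "j \<in> {..<n}" for j
    using measurable_compose[of "\<lambda>x. x j" ?M cube_measure \<phi> borel] that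
      measurable_component_singleton[of j "{..<n}" "\<lambda>_. cube_measure"] assms(3) by simp
  define occ where "occ x = {j. j < n \<and> cell k (x j) = i}" for x :: "nat \<Rightarrow> real ^ 'd"
  define occ_ind where "occ_ind S x = ((\<Prod>j\<in>{..<n} - S. indicator (- ?D) (x j)) * (\<Prod>j\<in>S. indicator ?D (x j)) :: ennreal)"
    for S and x :: "nat \<Rightarrow> real ^ 'd"
  have occ_ind: "occ_ind S x = (if occ x = S then 1 else 0)" if "S \<subseteq> {..<n}" for S x
  proof (cases "occ x = S")
    case True
    then show ?thesis by (auto simp: occ_ind_def occ_def indicator_def)
  next
    case False
    then obtain j where "j \<in> occ x \<longleftrightarrow> j \<notin> S" by blast
    then have "j < n" "j \<in> S \<longleftrightarrow> cell k (x j) \<noteq> i"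
      using that by (auto simp: occ_def)
    then show ?thesis
      using False that finite_subset[OF that] by (cases "j \<in> S") (auto simp: occ_ind_def indicator_def prod_zero_iff)
  qed
  \<comment> \<open>exactly one set of labels is the set of points in the cell\<close>
  have partition: "v = (\<Sum>S\<in>Pow {..<n}. occ_ind S x * v)" for v and x
  proof -
    have "(\<Sum>S\<in>Pow {..<n}. occ_ind S x * v) = (\<Sum>S\<in>Pow {..<n}. if occ x = S then v else 0)"
      by (intro sum.cong) (auto simp: occ_ind)
    also have "\<dots> = v" by (subst sum.delta') (auto simp: occ_def)
    finally show ?thesis by simp
  qed
  have meas [measurable]: "occ_ind S \<in> borel_measurable ?M" if S: "S \<subseteq> {..<n}" for S
  proof -
    have "Measurable.pred ?M (\<lambda>x. occ x = S)"
      unfolding occ_def set_eq_iff using S by (simp, measurable)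
    then have "(\<lambda>x. if occ x = S then 1 else 0 :: ennreal) \<in> borel_measurable ?M" by measurable
    then show ?thesis using occ_ind[OF S] by (simp cong: measurable_cong)
  qed
  \<comment> \<open>on one piece the outer points \<open>x\<close> contribute a factor \<open>G\<close>; the corner of the cell stands for any inner point\<close>
  have fubini: "(\<integral>\<^sup>+x. occ_ind S x * (ennreal (f (\<Sum>j\<in>S. \<phi> (x j))) * gibbs_weight \<beta> {..<n} x) \<partial>?M)
    = (\<integral>\<^sup>+x. G S x * (\<integral>\<^sup>+y. (\<Prod>j\<in>S. indicator ?D (y j)) * (ennreal (f (\<Sum>j\<in>S. \<phi> (y j))) * gibbs_weight \<beta> S y) \<partial>config S) \<partial>config ({..<n} - S))"
    if "S \<subseteq> {..<n}" "f \<in> borel_measurable borel" and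
     "G = (\<lambda>S x. (\<Prod>j\<in>{..<n} - S. indicator (- ?D) (x j)) * ennreal (exp (- (\<beta> *
           (energy ({..<n} - S) x + 2 * (\<Sum>a\<in>S. \<Sum>c\<in>{..<n} - S. hier_potential (into_cell k i 0) (x c)))))))"
     for S f G
  proof -
    define R where "R = {..<n} - S"
    have un: "R \<union> S = {..<n}" and disj: "R \<inter> S = {}" and fin: "finite R" "finite S"
      using that finite_subset[of S] by (auto simp: R_def)
    note G = that(3)[folded R_def]
    have [measurable]: "f \<in> borel_measurable borel" by fact
    have comp: "(\<lambda>x. \<phi> (x j)) \<in> borel_measurable ?M" if "j \<in> S" for j
      using that un by (intro point) auto
    have meas2: "(\<lambda>x. occ_ind S x * (ennreal (f (\<Sum>j\<in>S. \<phi> (x j))) * gibbs_weight \<beta> {..<n} x)) \<in> borel_measurable ?M"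
      using comp meas[OF that(1)] by measurable
    have "(\<integral>\<^sup>+x. occ_ind S x * (ennreal (f (\<Sum>j\<in>S. \<phi> (x j))) * gibbs_weight \<beta> {..<n} x) \<partial>?M)
      = (\<integral>\<^sup>+x. \<integral>\<^sup>+y. occ_ind S (merge R S (x, y)) * (ennreal (f (\<Sum>j\<in>S. \<phi> (merge R S (x, y) j))) * gibbs_weight \<beta> {..<n} (merge R S (x, y)))
            \<partial>config S \<partial>config R)"
      using cube.product_nn_integral_fold[OF disj fin, of "\<lambda>x. occ_ind S x * (ennreal (f (\<Sum>j\<in>S. \<phi> (x j))) * gibbs_weight \<beta> {..<n} x)"] meas2
      by (simp only: un)
    also have "\<dots> = (\<integral>\<^sup>+x. (\<integral>\<^sup>+y. G S x * ((\<Prod>j\<in>S. indicator ?D (y j)) * (ennreal (f (\<Sum>j\<in>S. \<phi> (y j))) * gibbs_weight \<beta> S y)) \<partial>config S) \<partial>config R)"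
    proof (intro nn_integral_cong)
      fix x y :: "nat \<Rightarrow> real ^ 'd"
      assume x: "x \<in> space (config R)" and y: "y \<in> space (config S)"
      let ?z = "merge R S (x, y)"
      have zR: "?z j = x j" if "j \<in> R" for j using that by (simp add: merge_def)
      have zS: "?z j = y j" if "j \<in> S" for j using that disj by (auto simp: merge_def)
      have occ_ind_merge: "occ_ind S ?z = (\<Prod>j\<in>R. indicator (- ?D) (x j)) * (\<Prod>j\<in>S. indicator ?D (y j))"
        unfolding occ_ind_def R_def[symmetric] by (simp add: zS zR cong: prod.cong)
      have sz: "(\<Sum>j\<in>S. \<phi> (?z j)) = (\<Sum>j\<in>S. \<phi> (y j))"
        by (simp add: zS cong: sum.cong)
      show "occ_ind S ?z * (ennreal (f (\<Sum>j\<in>S. \<phi> (?z j))) * gibbs_weight \<beta> {..<n} ?z)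
         = G S x * ((\<Prod>j\<in>S. indicator ?D (y j)) * (ennreal (f (\<Sum>j\<in>S. \<phi> (y j))) * gibbs_weight \<beta> S y))"
      proof (cases "(\<forall>j\<in>S. cell k (y j) = i) \<and> (\<forall>j\<in>R. cell k (x j) \<noteq> i)")
        case False
        then have "(\<Prod>j\<in>R. indicator (- ?D) (x j) :: ennreal) = 0 \<or> (\<Prod>j\<in>S. indicator ?D (y j) :: ennreal) = 0"
          using fin by (auto simp: prod_zero_iff indicator_def)
        then show ?thesis unfolding occ_ind_merge G R_def[symmetric]
          by (elim disjE) (simp_all only: mult_zero_left mult_zero_right)
      next
        case True
        have p: "into_cell k i 0 \<in> half_open_cube" "cell k (into_cell k i 0) = i"
        proof -
          have "(0 :: real ^ 'd) \<in> half_open_cube" by (simp add: half_open_cube_def)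
          then show "cell k (into_cell k i 0) = i" by (rule cell_into_cell_same)
          then show "into_cell k i 0 \<in> half_open_cube" using i cell_in_grid_iff by metis
        qed
        have far: "hier_potential (y a) (x c) = hier_potential (into_cell k i 0) (x c)"
          if "a \<in> S" "c \<in> R" for a c
          using True that p config_in_cube[OF y, of a] config_in_cube[OF x, of c]
          by (intro hier_potential_far[of _ _ _ k]) auto
        have "energy {..<n} ?z = energy R ?z + energy S ?z + 2 * (\<Sum>a\<in>S. \<Sum>c\<in>R. hier_potential (?z a) (?z c))"
          using energy_Un[OF fin disj] by (simp only: un)
        also have "energy R ?z = energy R x" by (simp add: energy_def zR)
        also have "energy S ?z = energy S y" by (simp add: energy_def zS)
        also have "(\<Sum>a\<in>S. \<Sum>c\<in>R. hier_potential (?z a) (?z c)) = (\<Sum>a\<in>S. \<Sum>c\<in>R. hier_potential (into_cell k i 0) (x c))"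
          by (intro sum.cong refl) (simp only: zR zS far)
        finally have "gibbs_weight \<beta> {..<n} ?z = ennreal (exp (- (\<beta> *
           (energy R x + 2 * (\<Sum>a\<in>S. \<Sum>c\<in>R. hier_potential (into_cell k i 0) (x c)))))) * gibbs_weight \<beta> S y"
          by (simp add: algebra_simps flip: ennreal_mult exp_add)
        then show ?thesis unfolding occ_ind_merge sz G R_def[symmetric] by (simp add: mult_ac)
      qed
    qed
    also have "\<dots> = (\<integral>\<^sup>+x. G S x * (\<integral>\<^sup>+y. (\<Prod>j\<in>S. indicator ?D (y j)) * (ennreal (f (\<Sum>j\<in>S. \<phi> (y j))) * gibbs_weight \<beta> S y) \<partial>config S) \<partial>config R)"
      by (intro nn_integral_cong nn_integral_cmult) measurable
    finally show ?thesis unfolding R_def .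
  qed
  define c where "c = ennreal (1 / partition_function TYPE('d) n \<beta>)"
  let ?Y = "\<lambda>x. \<Sum>j<n. if cell k (x j) = i then \<phi> (x j) else 0"
  have Y_meas: "(\<lambda>x. ennreal ((?Y x)\<^sup>2)) \<in> borel_measurable ?M"
    by (intro measurable_compose[OF _ measurable_ennreal] borel_measurable_power borel_measurable_sum
        measurable_If point cellpred) auto
  have b_meas: "(\<lambda>x. ennreal (b (count_in n k i x))) \<in> borel_measurable ?M"
  proof -
    have "(\<lambda>x. ennreal (b (card (occ x)))) = (\<lambda>x. \<Sum>S\<in>Pow {..<n}. occ_ind S x * ennreal (b (card S)))"
      by (rule ext, subst partition) (auto simp: occ_ind intro!: sum.cong)
    also have "\<dots> \<in> borel_measurable ?M" by (intro borel_measurable_sum borel_measurable_times_ennreal meas) auto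
    finally show ?thesis by (simp add: count_in_def occ_def)
  qed
  have Y: "occ_ind S x * (ennreal ((?Y x)\<^sup>2) * gibbs_weight \<beta> {..<n} x)
      = occ_ind S x * (ennreal ((\<Sum>j\<in>S. \<phi> (x j))\<^sup>2) * gibbs_weight \<beta> {..<n} x)" if "S \<subseteq> {..<n}" for S x
  proof (cases "occ x = S")
    case True
    have "?Y x = (\<Sum>j\<in>occ x. \<phi> (x j))"
      by (simp add: occ_def sum.If_cases Int_def)
    then show ?thesis using True by simp
  qed (simp add: occ_ind that)
  have B: "occ_ind S x * (ennreal (b (card S)) * gibbs_weight \<beta> {..<n} x)
      = occ_ind S x * (ennreal (b (count_in n k i x)) * gibbs_weight \<beta> {..<n} x)" if "S \<subseteq> {..<n}" for S x
    by (auto simp: occ_ind that occ_def count_in_def)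
  have piece: "(\<integral>\<^sup>+x. occ_ind S x * (ennreal ((?Y x)\<^sup>2) * gibbs_weight \<beta> {..<n} x) \<partial>?M)
     \<le> (\<integral>\<^sup>+x. occ_ind S x * (ennreal (b (count_in n k i x)) * gibbs_weight \<beta> {..<n} x) \<partial>?M)" if S: "S \<subseteq> {..<n}" for S
  proof -
    have fin: "finite S" and card: "card S \<le> n"
      using S finite_subset card_mono[OF _ S] by auto
    have "(\<integral>\<^sup>+y. (\<Prod>j\<in>S. indicator ?D (y j)) * (ennreal ((\<Sum>j\<in>S. \<phi> (y j))\<^sup>2) * gibbs_weight \<beta> S y) \<partial>config S)
      \<le> ennreal (b (card S)) * (\<integral>\<^sup>+y. (\<Prod>j\<in>S. indicator ?D (y j)) * gibbs_weight \<beta> S y \<partial>config S)"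
      by (rule block_bound[OF \<beta> i fin assms(3) bound[OF card]])
    also have "\<dots> = (\<integral>\<^sup>+y. ennreal (b (card S)) * ((\<Prod>j\<in>S. indicator ?D (y j)) * gibbs_weight \<beta> S y) \<partial>config S)"
      by (rule nn_integral_cmult[symmetric]) measurable
    finally have le: "(\<integral>\<^sup>+y. (\<Prod>j\<in>S. indicator ?D (y j)) * (ennreal ((\<Sum>j\<in>S. \<phi> (y j))\<^sup>2) * gibbs_weight \<beta> S y) \<partial>config S)
      \<le> (\<integral>\<^sup>+y. (\<Prod>j\<in>S. indicator ?D (y j)) * (ennreal (b (card S)) * gibbs_weight \<beta> S y) \<partial>config S)"
      by (simp only: mult_ac)
    show ?thesis
      unfolding Y[OF S] B[OF S, symmetric]
      by (subst fubini[OF S _ refl, of "\<lambda>s. s\<^sup>2"], measurable,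
          subst fubini[OF S _ refl, of "\<lambda>_. b (card S)"], measurable)
        (intro nn_integral_mono mult_left_mono le, auto)
  qed
  have "(\<integral>\<^sup>+x. ennreal ((?Y x)\<^sup>2) \<partial>hier_coulomb_gas n \<beta>)
     = c * (\<integral>\<^sup>+x. (\<Sum>S\<in>Pow {..<n}. occ_ind S x * (ennreal ((?Y x)\<^sup>2) * gibbs_weight \<beta> {..<n} x)) \<partial>?M)"
    unfolding c_def by (subst nn_integral_gas[OF \<beta> Y_meas]) (intro arg_cong2[where f = "(*)"] refl nn_integral_cong partition partition[symmetric])
  also have "\<dots> = c * (\<Sum>S\<in>Pow {..<n}. \<integral>\<^sup>+x. occ_ind S x * (ennreal ((?Y x)\<^sup>2) * gibbs_weight \<beta> {..<n} x) \<partial>?M)"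
    by (subst nn_integral_sum) (auto intro!: borel_measurable_times_ennreal meas Y_meas)
  also have "\<dots> \<le> c * (\<Sum>S\<in>Pow {..<n}. \<integral>\<^sup>+x. occ_ind S x * (ennreal (b (count_in n k i x)) * gibbs_weight \<beta> {..<n} x) \<partial>?M)"
    by (intro mult_left_mono sum_mono piece) auto
  also have "\<dots> = c * (\<integral>\<^sup>+x. (\<Sum>S\<in>Pow {..<n}. occ_ind S x * (ennreal (b (count_in n k i x)) * gibbs_weight \<beta> {..<n} x)) \<partial>?M)"
    by (subst nn_integral_sum) (auto intro!: borel_measurable_times_ennreal meas b_meas)
  also have "\<dots> = (\<integral>\<^sup>+x. ennreal (b (count_in n k i x)) \<partial>hier_coulomb_gas n \<beta>)"
    unfolding c_def by (subst nn_integral_gas[OF \<beta> b_meas]) (intro arg_cong2[where f = "(*)"] refl nn_integral_cong partition partition[symmetric])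
  finally show ?thesis .
qed

section \<open>Orthogonality and size of the increments at one cell\<close>

definition children :: "('d::finite \<Rightarrow> int) \<Rightarrow> ('d \<Rightarrow> int) set" where
  "children i = {c. parent c = i}"

lemma bij_betw_children:
  "bij_betw (\<lambda>e l. 2 * i l + e l) (grid 1) (children (i :: 'd::finite \<Rightarrow> int))"
proof (rule bij_betwI[where g = "\<lambda>c l. c l - 2 * i l"])
  show "(\<lambda>e l. 2 * i l + e l) \<in> grid 1 \<rightarrow> children i"
    by (auto simp: grid_def children_def parent_def fun_eq_iff)
  show "(\<lambda>c l. c l - 2 * i l) \<in> children i \<rightarrow> grid 1"
  proof
    fix c assume "c \<in> children i"
    then have "i l = c l div 2" for l by (auto simp: children_def parent_def)
    then show "(\<lambda>l. c l - 2 * i l) \<in> grid 1"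
      by (auto simp: grid_def minus_mult_div_eq_mod)
  qed
qed auto

lemma finite_children: "finite (children (i :: 'd::finite \<Rightarrow> int))"
  using bij_betw_finite[OF bij_betw_children] finite_grid by blast

lemma card_children: "card (children (i :: 'd::finite \<Rightarrow> int)) = 2 ^ CARD('d)"
  using bij_betw_same_card[OF bij_betw_children[of i]] card_grid[of 1, where 'd='d] by simp

lemma count_in_eq_sum: "real (count_in n k i x) = (\<Sum>j<n. if cell k (x j) = i then 1 else 0)"
  by (simp add: count_in_def sum.If_cases lessThan_def Int_def)

lemma count_in_le: "count_in n k i x \<le> n"
proof -
  have "card {j. j < n \<and> cell k (x j) = i} \<le> card {..<n}" by (intro card_mono) auto
  then show ?thesis by (simp add: count_in_def)
qed

lemma sum_over_cells:
  assumes "finite A" "\<And>j. j < n \<Longrightarrow> P j \<Longrightarrow> cell k (x j) \<in> A" "\<And>j. j < n \<Longrightarrow> cell k (x j) \<in> A \<Longrightarrow> P j"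
  shows "(\<Sum>c\<in>A. \<alpha> c * real (count_in n k c x)) = (\<Sum>j<n. if P j then \<alpha> (cell k (x j)) else 0)"
proof -
  have "(\<Sum>c\<in>A. \<alpha> c * real (count_in n k c x))
      = (\<Sum>c\<in>A. \<Sum>j<n. if cell k (x j) = c then \<alpha> c else 0)"
    by (simp add: count_in_eq_sum sum_distrib_left if_distrib cong: if_cong)
  also have "\<dots> = (\<Sum>j<n. \<Sum>c\<in>A. if cell k (x j) = c then \<alpha> c else 0)"
    by (rule sum.swap)
  also have "\<dots> = (\<Sum>j<n. if P j then \<alpha> (cell k (x j)) else 0)"
    using assms by (intro sum.cong refl) (auto simp: sum.delta')
  finally show ?thesis .
qed

lemma cell_config_measurable:
  assumes "j \<in> I"
  shows "Measurable.pred (config I) (\<lambda>x. cell k (x j) = i)"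
  using measurable_compose[of "\<lambda>x. x j" "config I" borel "\<lambda>x. cell k x = i" "count_space UNIV"]
    measurable_component_singleton[of j I "\<lambda>_. cube_measure"] assms
  by (simp add: cell_measurable measurable_cube_measure_borel)

lemma count_in_measurable [measurable]:
  "(\<lambda>x. real (count_in n k i x)) \<in> borel_measurable (config {..<n})"
  unfolding count_in_eq_sum
  by (intro borel_measurable_sum measurable_If cell_config_measurable) auto

text \<open>All random variables below are bounded on the configurations in the unit cube. This closed class makes
their integrability immediate.\<close>

definition bounded_obs :: "nat \<Rightarrow> ((nat \<Rightarrow> real ^ 'd::finite) \<Rightarrow> real) \<Rightarrow> bool" where
  "bounded_obs n X \<longleftrightarrow> X \<in> borel_measurable (config {..<n}) \<and>
     (\<exists>B. \<forall>x \<in> space (config {..<n}). \<bar>X x\<bar> \<le> B)"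

lemma bounded_obs_const: "bounded_obs n (\<lambda>_. c)"
  by (auto simp: bounded_obs_def)

lemma bounded_obs_add:
  assumes "bounded_obs n X" "bounded_obs n Y"
  shows "bounded_obs n (\<lambda>x. X x + Y x)"
proof -
  obtain B C where "\<forall>x \<in> space (config {..<n}). \<bar>X x\<bar> \<le> B" "\<forall>x \<in> space (config {..<n}). \<bar>Y x\<bar> \<le> C"
    using assms by (auto simp: bounded_obs_def)
  then have "\<forall>x \<in> space (config {..<n}). \<bar>X x + Y x\<bar> \<le> B + C"
    by (smt (verit))
  then show ?thesis using assms by (auto simp: bounded_obs_def)
qed

lemma bounded_obs_mult:
  assumes "bounded_obs n X" "bounded_obs n Y"
  shows "bounded_obs n (\<lambda>x. X x * Y x)"
proof -
  obtain B C where *: "\<forall>x \<in> space (config {..<n}). \<bar>X x\<bar> \<le> B" "\<forall>x \<in> space (config {..<n}). \<bar>Y x\<bar> \<le> C"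
    using assms by (auto simp: bounded_obs_def)
  have "\<forall>x \<in> space (config {..<n}). \<bar>X x * Y x\<bar> \<le> B * C"
    unfolding abs_mult using * by (intro ballI mult_mono') auto
  then show ?thesis using assms by (auto simp: bounded_obs_def)
qed

lemma bounded_obs_diff:
  assumes "bounded_obs n X" "bounded_obs n Y"
  shows "bounded_obs n (\<lambda>x. X x - Y x)"
  using bounded_obs_add[OF assms(1) bounded_obs_mult[OF bounded_obs_const[of n "-1"] assms(2)]] by simp

lemma bounded_obs_power2: "bounded_obs n X \<Longrightarrow> bounded_obs n (\<lambda>x. (X x)\<^sup>2)"
  unfolding power2_eq_square by (rule bounded_obs_mult)

lemma bounded_obs_sum: "(\<And>i. i \<in> I \<Longrightarrow> bounded_obs n (X i)) \<Longrightarrow> bounded_obs n (\<lambda>x. \<Sum>i\<in>I. X i x)"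
  by (induction I rule: infinite_finite_induct) (auto intro: bounded_obs_const bounded_obs_add)

lemma bounded_obs_count: "bounded_obs n (\<lambda>x. real (count_in n k i x))"
  unfolding bounded_obs_def by (intro conjI count_in_measurable exI[of _ "real n"]) (simp add: count_in_le)

lemma bounded_obs_fun_count: "bounded_obs n (\<lambda>x. g (count_in n k i x))"
proof -
  have [measurable]: "(\<lambda>x. count_in n k i x) \<in> config {..<n} \<rightarrow>\<^sub>M count_space UNIV"
  proof -
    have "(\<lambda>x. nat \<lfloor>real (count_in n k i x)\<rfloor>) \<in> config {..<n} \<rightarrow>\<^sub>M count_space UNIV"
      by measurable
    then show ?thesis by simp
  qed
  have "\<bar>g (count_in n k i x)\<bar> \<le> (\<Sum>m\<le>n. \<bar>g m\<bar>)" for x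
    by (rule member_le_sum[where f = "\<lambda>m. \<bar>g m\<bar>"]) (auto simp: count_in_le)
  then show ?thesis unfolding bounded_obs_def by (intro conjI exI) (measurable, auto)
qed

lemmas bounded_obs_intros = bounded_obs_const bounded_obs_add bounded_obs_mult bounded_obs_diff
  bounded_obs_power2 bounded_obs_sum bounded_obs_count bounded_obs_fun_count

lemma bounded_obs_integrable:
  assumes "\<beta> > 0" "bounded_obs n X"
  shows "integrable (hier_coulomb_gas n \<beta>) X"
proof -
  interpret prob_space "hier_coulomb_gas n \<beta>" by (rule prob_space_gas[OF assms(1)])
  obtain B where "\<forall>x \<in> space (config {..<n}). \<bar>X x\<bar> \<le> B"
    using assms by (auto simp: bounded_obs_def)
  then show ?thesis
    using assms(2) by (intro integrable_const_bound[where B = B])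
      (auto simp: bounded_obs_def space_gas measurable_cong_sets[OF sets_gas refl] intro!: AE_I2)
qed

text \<open>Invariance of the gas under the exchange of two siblings, applied to the number of points in one of them
multiplied by an observable that does not notice the exchange.\<close>

lemma sibling_counts_exchangeable:
  assumes \<beta>: "\<beta> > 0" and sib: "parent a = parent b" and G: "bounded_obs n G"
    and inv: "\<And>x. x \<in> space (config {..<n}) \<Longrightarrow> G (compose {..<n} (swap_cells (Suc k) a b) x) = G x"
  shows "(\<integral>x. real (count_in n (Suc k) a x) * G x \<partial>hier_coulomb_gas n \<beta>)
       = (\<integral>x. real (count_in n (Suc k) b x) * G x \<partial>hier_coulomb_gas n \<beta>)"
proof -
  have cnt: "count_in n (Suc k) a (compose {..<n} (swap_cells (Suc k) a b) x) = count_in n (Suc k) b x" for x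
  proof -
    have "Transposition.transpose a b c = a \<longleftrightarrow> c = b" for c
      by (auto simp: Transposition.transpose_def)
    then show ?thesis
      unfolding count_in_def by (intro arg_cong[where f = card]) (auto simp: compose_def cell_swap)
  qed
  have "(\<integral>x. real (count_in n (Suc k) a x) * G x \<partial>hier_coulomb_gas n \<beta>)
    = (\<integral>x. real (count_in n (Suc k) a (compose {..<n} (swap_cells (Suc k) a b) x))
          * G (compose {..<n} (swap_cells (Suc k) a b) x) \<partial>hier_coulomb_gas n \<beta>)"
    by (rule gas_swap_invariant[OF \<beta> sib, symmetric]) (use G in \<open>auto simp: bounded_obs_def\<close>)
  also have "\<dots> = (\<integral>x. real (count_in n (Suc k) b x) * G x \<partial>hier_coulomb_gas n \<beta>)"
    by (intro Bochner_Integration.integral_cong refl) (simp add: cnt inv space_gas)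
  finally show ?thesis .
qed

text \<open>The contribution of the children of one cell \<open>i\<close> of level \<open>k\<close> to the linear statistic; the coefficients
\<open>\<alpha>\<close> are attached to the children.\<close>

definition cell_increment :: "nat \<Rightarrow> nat \<Rightarrow> (('d \<Rightarrow> int) \<Rightarrow> real) \<Rightarrow> ('d \<Rightarrow> int) \<Rightarrow> (nat \<Rightarrow> real ^ 'd::finite) \<Rightarrow> real" where
  "cell_increment n k \<alpha> i x = (\<Sum>c\<in>children i. \<alpha> c * real (count_in n (Suc k) c x))"

lemma cell_increment_eq:
  "cell_increment n k \<alpha> i x = (\<Sum>j<n. if cell k (x j) = i then \<alpha> (cell (Suc k) (x j)) else 0)"
  unfolding cell_increment_def
  by (rule sum_over_cells)
    (auto simp: finite_children[unfolded children_def] children_def parent_cell)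

lemma bounded_obs_increment: "bounded_obs n (cell_increment n k \<alpha> i)"
  unfolding cell_increment_def by (intro bounded_obs_intros)

text \<open>Exchanging two children of the finer cell \<open>i\<close> does not affect the increment at \<open>i'\<close>: its counts are either
on a level that is too coarse to notice, or of cells that are not children of \<open>i\<close>. Hence the correlation
of the increment at \<open>i'\<close> with the count in a child of \<open>i\<close> is the same for all these children,
and coefficients of sum zero cancel it.\<close>

lemma increments_orthogonal:
  assumes \<beta>: "\<beta> > 0" and k': "k' \<le> k" and ne: "k' = k \<Longrightarrow> i' \<noteq> i"
    and mean: "(\<Sum>c\<in>children i. \<alpha> c) = 0"
  shows "(\<integral>x. cell_increment n k \<alpha> i x * cell_increment n k' \<alpha>' i' x \<partial>hier_coulomb_gas n \<beta>) = 0"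
proof -
  let ?G = "cell_increment n k' \<alpha>' i'" and ?M = "hier_coulomb_gas n \<beta>"
  have inv: "?G (compose {..<n} (swap_cells (Suc k) a b) x) = ?G x" if ab: "a \<in> children i" "b \<in> children i" for a b x
  proof -
    have sib: "parent a = parent b" using ab by (simp add: children_def)
    have "cell (Suc k') (swap_cells (Suc k) a b y) = c \<longleftrightarrow> cell (Suc k') y = c" if "c \<in> children i'" for c y
    proof (cases "k' = k")
      case True
      then have "c \<noteq> a" "c \<noteq> b" using ne that ab by (auto simp: children_def)
      then show ?thesis using True by (auto simp: cell_swap Transposition.transpose_def)
    next
      case False
      then show ?thesis using k' cell_swap_coarse[OF sib] by simp
    qed
    then show ?thesis
      unfolding cell_increment_def count_in_def
      by (intro sum.cong refl arg_cong2[where f = "(*)"] arg_cong[where f = real] arg_cong[where f = card])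
        (auto simp: compose_def)
  qed
  obtain c0 where c0: "c0 \<in> children i" using card_children[of i] by (metis card.empty ex_in_conv power_not_zero zero_neq_numeral)
  have G: "bounded_obs n ?G" by (rule bounded_obs_increment)
  have same: "(\<integral>x. real (count_in n (Suc k) c x) * ?G x \<partial>?M) = (\<integral>x. real (count_in n (Suc k) c0 x) * ?G x \<partial>?M)"
    if "c \<in> children i" for c
    using that c0 inv G by (intro sibling_counts_exchangeable[OF \<beta>]) (auto simp: children_def)
  have "(\<integral>x. cell_increment n k \<alpha> i x * ?G x \<partial>?M)
      = (\<integral>x. (\<Sum>c\<in>children i. \<alpha> c * (real (count_in n (Suc k) c x) * ?G x)) \<partial>?M)"
    by (simp add: cell_increment_def[of n k] sum_distrib_right mult.assoc)
  also have "\<dots> = (\<Sum>c\<in>children i. \<alpha> c * (\<integral>x. real (count_in n (Suc k) c x) * ?G x \<partial>?M))"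
    by (subst Bochner_Integration.integral_sum)
      (auto intro!: bounded_obs_integrable[OF \<beta>] bounded_obs_intros G)
  also have "\<dots> = (\<Sum>c\<in>children i. \<alpha> c) * (\<integral>x. real (count_in n (Suc k) c0 x) * ?G x \<partial>?M)"
    by (simp add: same sum_distrib_right)
  finally show ?thesis by (simp add: mean)
qed

text \<open>By exchangeability all the \<open>2 ^ d\<close> counts have the same mean, so coefficients of sum zero allow the counts to
be centred. The Cauchy-Schwarz inequality then reduces to the variances of the single counts; one factor
\<open>2 ^ d\<close> comes from it and another from the number of cells.\<close>

lemma top_increment_second_moment:
  fixes \<gamma> :: "('d::finite \<Rightarrow> int) \<Rightarrow> real"
  assumes \<beta>: "\<beta> > 0" and mean: "(\<Sum>e\<in>grid 1. \<gamma> e) = 0"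
    and le: "\<And>e. e \<in> grid 1 \<Longrightarrow> \<bar>\<gamma> e\<bar> \<le> a"
    and var: "\<And>e :: 'd \<Rightarrow> int. e \<in> grid 1 \<Longrightarrow> prob_space.variance (hier_coulomb_gas m \<beta>) (\<lambda>x. real (count_in m 1 e x)) \<le> v"
  shows "(\<integral>x. (\<Sum>e\<in>grid 1. \<gamma> e * real (count_in m 1 e x))\<^sup>2 \<partial>hier_coulomb_gas m \<beta>) \<le> 4 ^ CARD('d) * a\<^sup>2 * v"
proof -
  let ?M = "hier_coulomb_gas m \<beta> :: (nat \<Rightarrow> real ^ 'd) measure"
  interpret prob_space ?M by (rule prob_space_gas[OF \<beta>])
  let ?N = "\<lambda>e x. real (count_in m 1 e x)"
  have parent0: "parent e = (\<lambda>_. 0)" if "e \<in> grid 1" for e :: "'d \<Rightarrow> int"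
    using that by (auto simp: grid_def parent_def fun_eq_iff)
  have zero: "(\<lambda>_. 0) \<in> grid 1" by (simp add: grid_def)
  define \<mu> where "\<mu> = expectation (?N (\<lambda>_. 0))"
  have \<mu>: "expectation (?N e) = \<mu>" if "e \<in> grid 1" for e
    using sibling_counts_exchangeable[OF \<beta>, of e "\<lambda>_. 0" m "\<lambda>_. 1" 0] parent0[OF that] parent0[OF zero]
    by (simp add: \<mu>_def bounded_obs_const)
  have pw: "(\<Sum>e\<in>grid 1. \<gamma> e * ?N e x)\<^sup>2 \<le> 2 ^ CARD('d) * (\<Sum>e\<in>grid 1. a\<^sup>2 * (?N e x - \<mu>)\<^sup>2)" for x
  proof -
    have "(\<Sum>e\<in>grid 1. \<gamma> e * ?N e x) = (\<Sum>e\<in>grid 1. \<gamma> e * (?N e x - \<mu>))"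
      using mean by (simp add: right_diff_distrib sum_subtractf flip: sum_distrib_right)
    also have "\<dots>\<^sup>2 \<le> (\<Sum>e\<in>(grid 1 :: ('d \<Rightarrow> int) set). 1\<^sup>2) * (\<Sum>e\<in>grid 1. (\<gamma> e * (?N e x - \<mu>))\<^sup>2)"
      using Cauchy_Schwarz_ineq_sum[of "\<lambda>_. 1" "\<lambda>e. \<gamma> e * (?N e x - \<mu>)" "grid 1"] by simp
    also have "\<dots> = 2 ^ CARD('d) * (\<Sum>e\<in>grid 1. (\<gamma> e * (?N e x - \<mu>))\<^sup>2)"
      using card_grid[of 1, where 'd='d] by simp
    also have "\<dots> \<le> 2 ^ CARD('d) * (\<Sum>e\<in>grid 1. a\<^sup>2 * (?N e x - \<mu>)\<^sup>2)"
      unfolding power_mult_distrib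
      by (intro mult_left_mono sum_mono mult_right_mono) (use le abs_le_square_iff in \<open>force+\<close>)
    finally show ?thesis .
  qed
  have "(\<integral>x. (\<Sum>e\<in>grid 1. \<gamma> e * ?N e x)\<^sup>2 \<partial>?M) \<le> (\<integral>x. 2 ^ CARD('d) * (\<Sum>e\<in>grid 1. a\<^sup>2 * (?N e x - \<mu>)\<^sup>2) \<partial>?M)"
    by (intro integral_mono pw bounded_obs_integrable[OF \<beta>] bounded_obs_intros)
  also have "\<dots> = 2 ^ CARD('d) * (\<Sum>e\<in>grid 1. a\<^sup>2 * (\<integral>x. (?N e x - \<mu>)\<^sup>2 \<partial>?M))"
    by (simp, subst Bochner_Integration.integral_sum) (auto intro!: bounded_obs_integrable[OF \<beta>] bounded_obs_intros)
  also have "\<dots> \<le> 2 ^ CARD('d) * (\<Sum>e\<in>(grid 1 :: ('d \<Rightarrow> int) set). a\<^sup>2 * v)"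
    using var \<mu> by (intro mult_left_mono sum_mono) auto
  also have "\<dots> = (2 * 2) ^ CARD('d) * a\<^sup>2 * v"
    using card_grid[of 1, where 'd='d] by (simp only: power_mult_distrib) simp
  finally show ?thesis by simp
qed

text \<open>The increment at a cell \<open>i\<close> is, inside that cell, a rescaled increment at the root, so
\<open>conditional_second_moment\<close> reduces its second moment to \<open>top_increment_second_moment\<close> at higher inverse
temperatures. The bound may vanish for an empty cell, which has no increment; this
is what makes the sum over the many cells of fine levels small.\<close>

lemma increment_second_moment:
  fixes \<alpha> :: "('d::finite \<Rightarrow> int) \<Rightarrow> real"
  assumes \<beta>: "\<beta> > 0" and i: "i \<in> grid k" and mean: "(\<Sum>c\<in>children i. \<alpha> c) = 0"
    and le: "\<And>c. c \<in> children i \<Longrightarrow> \<bar>\<alpha> c\<bar> \<le> a"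
    and h: "h 0 = 0" "\<And>m. h m \<ge> 0" and \<kappa>: "\<kappa> \<ge> 0"
    and var: "\<And>m \<beta>' (e :: 'd \<Rightarrow> int). m \<ge> 1 \<Longrightarrow> \<beta>' \<ge> \<beta> \<Longrightarrow> e \<in> grid 1 \<Longrightarrow>
        prob_space.variance (hier_coulomb_gas m \<beta>') (\<lambda>x. real (count_in m 1 e x)) \<le> \<kappa> * h m"
  shows "(\<integral>x. (cell_increment n k \<alpha> i x)\<^sup>2 \<partial>hier_coulomb_gas n \<beta>)
      \<le> 4 ^ CARD('d) * a\<^sup>2 * \<kappa> * (\<integral>x. h (count_in n k i x) \<partial>hier_coulomb_gas n \<beta>)"
proof -
  define \<phi> where "\<phi> x = (\<Sum>c\<in>children i. if cell (Suc k) x = c then \<alpha> c else 0)" for x :: "real ^ 'd"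
  define b where "b m = 4 ^ CARD('d) * a\<^sup>2 * (\<kappa> * h m)" for m
  have b: "b m \<ge> 0" for m using h \<kappa> by (simp add: b_def)
  define \<beta>' where "\<beta>' = \<beta> * 2 ^ ((CARD('d) - 2) * k)"
  have \<beta>': "\<beta>' \<ge> \<beta>" using \<beta> by (simp add: \<beta>'_def)
  have cell_pred: "Measurable.pred cube_measure (\<lambda>x :: real ^ 'd. cell (Suc k) x = c)" for c
    unfolding cube_measure_def by (intro measurable_restrict_space1) simp
  have \<phi>_meas: "\<phi> \<in> borel_measurable cube_measure"
    unfolding \<phi>_def by (intro borel_measurable_sum measurable_If cell_pred) auto
  have \<phi>: "\<phi> x = (if cell k x = i then \<alpha> (cell (Suc k) x) else 0)" for x
    unfolding \<phi>_def using finite_children[of i] parent_cell[of k x]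
    by (auto simp: children_def)
  have incr: "cell_increment n k \<alpha> i x = (\<Sum>j<n. if cell k (x j) = i then \<phi> (x j) else 0)" for x
    unfolding cell_increment_eq by (intro sum.cong refl) (simp add: \<phi>)
  have bound: "(\<integral>\<^sup>+x. ennreal ((\<Sum>j<m. \<phi> (into_cell k i (x j)))\<^sup>2) \<partial>hier_coulomb_gas m \<beta>') \<le> ennreal (b m)" for m
  proof -
    define \<gamma> where "\<gamma> e = \<alpha> (\<lambda>l. 2 * i l + e l)" for e
    have emb: "(\<Sum>j<m. \<phi> (into_cell k i (x j))) = (\<Sum>e\<in>grid 1. \<gamma> e * real (count_in m 1 e x))"
      if x: "x \<in> space (config {..<m})" for x
    proof -
      have "(\<Sum>e\<in>grid 1. \<gamma> e * real (count_in m 1 e x)) = (\<Sum>j<m. if True then \<gamma> (cell 1 (x j)) else 0)"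
        by (rule sum_over_cells) (auto simp: finite_grid intro!: cell_in_grid config_in_cube[OF x])
      also have "\<dots> = (\<Sum>j<m. \<phi> (into_cell k i (x j)))"
        using config_in_cube[OF x] cell_into_cell[of k 1 i]
        by (intro sum.cong refl) (simp add: \<phi> \<gamma>_def cell_into_cell_same)
      finally show ?thesis by simp
    qed
    show ?thesis
    proof (cases "m = 0")
      case True
      then show ?thesis by simp
    next
      case False
      have pos: "\<beta>' > 0" using \<beta> \<beta>' by linarith
      have g1: "(\<Sum>e\<in>grid 1. \<gamma> e) = 0"
        unfolding \<gamma>_def using sum.reindex_bij_betw[OF bij_betw_children[of i], of \<alpha>] mean by simp
      have g2: "\<bar>\<gamma> e\<bar> \<le> a" if "e \<in> grid 1" for e
        unfolding \<gamma>_def using that bij_betw_children[of i] by (intro le) (auto simp: bij_betw_def)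
      have "(\<integral>\<^sup>+x. ennreal ((\<Sum>j<m. \<phi> (into_cell k i (x j)))\<^sup>2) \<partial>hier_coulomb_gas m \<beta>')
         = (\<integral>\<^sup>+x. ennreal ((\<Sum>e\<in>grid 1. \<gamma> e * real (count_in m 1 e x))\<^sup>2) \<partial>hier_coulomb_gas m \<beta>')"
        by (intro nn_integral_cong) (simp add: emb space_gas)
      also have "\<dots> = ennreal (\<integral>x. (\<Sum>e\<in>grid 1. \<gamma> e * real (count_in m 1 e x))\<^sup>2 \<partial>hier_coulomb_gas m \<beta>')"
        by (intro nn_integral_eq_integral bounded_obs_integrable[OF pos] bounded_obs_intros) simp
      also have "\<dots> \<le> ennreal (b m)"
        unfolding b_def
        by (intro ennreal_leI top_increment_second_moment[OF pos g1 g2] var \<beta>') (use False in auto)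
      finally show ?thesis .
    qed
  qed
  have "ennreal (\<integral>x. (cell_increment n k \<alpha> i x)\<^sup>2 \<partial>hier_coulomb_gas n \<beta>)
     = (\<integral>\<^sup>+x. ennreal ((cell_increment n k \<alpha> i x)\<^sup>2) \<partial>hier_coulomb_gas n \<beta>)"
    by (intro nn_integral_eq_integral[symmetric] bounded_obs_integrable[OF \<beta>] bounded_obs_intros bounded_obs_increment) simp
  also have "\<dots> \<le> (\<integral>\<^sup>+x. ennreal (b (count_in n k i x)) \<partial>hier_coulomb_gas n \<beta>)"
    unfolding incr by (rule conditional_second_moment[OF \<beta> i \<phi>_meas bound[unfolded \<beta>'_def]])
  also have "\<dots> = ennreal (\<integral>x. b (count_in n k i x) \<partial>hier_coulomb_gas n \<beta>)"
    by (intro nn_integral_eq_integral bounded_obs_integrable[OF \<beta>] bounded_obs_intros) (simp add: b)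
  finally have "(\<integral>x. (cell_increment n k \<alpha> i x)\<^sup>2 \<partial>hier_coulomb_gas n \<beta>) \<le> (\<integral>x. b (count_in n k i x) \<partial>hier_coulomb_gas n \<beta>)"
    by (subst (asm) ennreal_le_iff) (auto intro!: Bochner_Integration.integral_nonneg b)
  also have "\<dots> = 4 ^ CARD('d) * a\<^sup>2 * \<kappa> * (\<integral>x. h (count_in n k i x) \<partial>hier_coulomb_gas n \<beta>)"
    unfolding b_def by (simp add: mult.assoc)
  finally show ?thesis .
qed

section \<open>Summing over the scales\<close>

text \<open>The growth of the assumed variance bound in the number of points, set to zero for the empty configuration.\<close>

definition log_gauge :: "nat \<Rightarrow> real" where
  "log_gauge m = (if m = 0 then 0 else max (ln (real m) ^ 12) 1)"

lemma log_gauge_nonneg: "log_gauge m \<ge> 0"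
  by (simp add: log_gauge_def le_max_iff_disj)

text \<open>With \<open>y = m powr (1 / 72)\<close> the logarithm of \<open>m\<close> is \<open>72 * ln y \<le> 72 * y\<close>, and \<open>y ^ 12 = m powr (1 / 6)\<close>. The
exponent \<open>1 / 6\<close> is small enough for the sum over the coarse levels to grow geometrically in every
dimension from three on.\<close>

lemma log_gauge_le: "log_gauge m \<le> 72 ^ 12 * real m powr (1 / 6)"
proof (cases "m = 0")
  case False
  define y where "y = real m powr (1 / 72)"
  have y: "y \<ge> 1" using False by (simp add: y_def ge_one_powr_ge_zero)
  have "ln (real m) = 72 * ln y" using False by (simp add: y_def ln_powr)
  also have "\<dots> \<le> 72 * y" using y ln_le_minus_one[of y] by simp
  finally have "ln (real m) ^ 12 \<le> (72 * y) ^ 12"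
    using False by (intro power_mono) auto
  moreover have "(1::real) ^ 12 \<le> (72 * y) ^ 12" using y by (intro power_mono) auto
  moreover have "y ^ 12 = real m powr (1 / 6)"
    using False by (simp add: y_def powr_realpow[symmetric] powr_powr)
  ultimately show ?thesis
    using False by (simp add: log_gauge_def power_mult_distrib)
qed (simp add: log_gauge_def)

text \<open>A substitute for concavity of the power function: the first term dominates for \<open>m \<le> t\<close>, the second one for
\<open>m > t\<close>. Summed over cells with mean occupation \<open>t\<close> it loses only a factor two against Jensen's
inequality.\<close>

lemma powr_le_affine:
  assumes "t > 0"
  shows "real m powr (1 / 6) \<le> t powr (1 / 6) + real m / t * t powr (1 / 6)"
proof (cases "real m \<le> t")
  case True
  then have "real m powr (1 / 6) \<le> t powr (1 / 6)" by (intro powr_mono2) auto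
  moreover have "real m / t * t powr (1 / 6) \<ge> 0" using assms by simp
  ultimately show ?thesis by linarith
next
  case False
  have split: "z powr (1 / 6) = z * z powr (- (5 / 6))" if "z > 0" for z :: real
    using that powr_add[of z 1 "- (5 / 6)"] by simp
  have "real m powr (1 / 6) = real m * real m powr (- (5 / 6))"
    using False assms by (intro split) linarith
  also have "\<dots> \<le> real m * t powr (- (5 / 6))"
    using False assms by (intro mult_left_mono powr_mono2') auto
  also have "\<dots> = real m / t * t powr (1 / 6)"
    using split[OF assms] assms by simp
  finally show ?thesis using powr_ge_zero[of t "1/6"] by linarith
qed

lemma sum_powr_le:
  fixes N :: "'a \<Rightarrow> nat"
  assumes "finite A" "A \<noteq> {}" "(\<Sum>i\<in>A. N i) = n" "n \<ge> 1"
  shows "(\<Sum>i\<in>A. real (N i) powr (1 / 6)) \<le> 2 * real (card A) * (real n / real (card A)) powr (1 / 6)"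
    and "(\<Sum>i\<in>A. real (N i) powr (1 / 6)) \<le> real n"
proof -
  define t where "t = real n / real (card A)"
  have P: "real (card A) > 0" using assms by (simp add: card_gt_0_iff)
  have t: "t > 0" using P assms by (simp add: t_def)
  have sum: "(\<Sum>i\<in>A. real (N i)) = real n" using assms by (simp flip: of_nat_sum)
  have "(\<Sum>i\<in>A. real (N i) powr (1 / 6)) \<le> (\<Sum>i\<in>A. t powr (1 / 6) + real (N i) / t * t powr (1 / 6))"
    by (intro sum_mono powr_le_affine t)
  also have "\<dots> = real (card A) * t powr (1 / 6) + (\<Sum>i\<in>A. real (N i)) / t * t powr (1 / 6)"
    by (simp add: sum.distrib sum_distrib_right sum_divide_distrib)
  also have "\<dots> = 2 * real (card A) * t powr (1 / 6)"
    using P assms unfolding sum by (simp add: t_def)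
  finally show "(\<Sum>i\<in>A. real (N i) powr (1 / 6)) \<le> 2 * real (card A) * (real n / real (card A)) powr (1 / 6)"
    by (simp add: t_def)
  have "real m powr (1 / 6) \<le> real m" for m :: nat
  proof (cases "m = 0")
    case False
    then have "real m powr (1 / 6) \<le> real m powr 1" by (intro powr_mono) auto
    then show ?thesis using False by simp
  qed simp
  then have "(\<Sum>i\<in>A. real (N i) powr (1 / 6)) \<le> (\<Sum>i\<in>A. real (N i))" by (intro sum_mono)
  then show "(\<Sum>i\<in>A. real (N i) powr (1 / 6)) \<le> real n" by (simp add: sum)
qed

text \<open>The terms grow by a factor \<open>sqrt 2\<close> as long as \<open>2 ^ k\<close> is below \<open>s\<close> and then decay by a factor four. Both
regimes are controlled by one induction: the partial sums are bounded by five times the square root of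
\<open>2 ^ M / s\<close> while this ratio is at most two (this works since \<open>5 + 2 \<le> 5 * sqrt 2\<close>), and by ten minus a
multiple of the decaying term afterwards.\<close>

lemma two_sided_geometric_sum:
  fixes s :: real and g :: "nat \<Rightarrow> real"
  assumes s: "s \<ge> 1"
    and low: "\<And>k. 2 ^ k \<le> s \<Longrightarrow> g k \<le> 2 * sqrt (2 ^ k / s)"
    and high: "\<And>k. 2 ^ k > s \<Longrightarrow> g k \<le> (s / 2 ^ k)\<^sup>2"
  shows "(\<Sum>k<M. g k) \<le> 10"
proof -
  have "(2 ^ M \<le> 2 * s \<longrightarrow> (\<Sum>k<M. g k) \<le> 5 * sqrt (2 ^ M / s)) \<and>
     (2 ^ M > s \<longrightarrow> (\<Sum>k<M. g k) \<le> 10 - 2 * (s / 2 ^ M)\<^sup>2)" for M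
  proof (induction M)
    case 0
    then show ?case using s by simp
  next
    case (Suc M)
    define y where "y = s / 2 ^ M"
    have sq: "sqrt 2 \<ge> 7 / 5" by (rule real_le_rsqrt) (simp add: power2_eq_square)
    have sq2: "sqrt 2 \<le> 3 / 2" by (rule real_le_lsqrt) (simp_all add: power2_eq_square)
    show ?case
    proof (cases "2 ^ M \<le> s")
      case True
      have split: "sqrt (2 ^ Suc M / s) = sqrt 2 * sqrt (2 ^ M / s)"
        by (simp flip: real_sqrt_mult)
      have nn: "sqrt (2 ^ M / s) \<ge> 0" using s by simp
      have "(\<Sum>k<Suc M. g k) \<le> 5 * sqrt (2 ^ M / s) + 2 * sqrt (2 ^ M / s)"
        using Suc low[OF True] True s by simp
      also have "\<dots> \<le> 5 * sqrt (2 ^ Suc M / s)"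
        unfolding split using mult_right_mono[OF sq nn] by simp
      finally have le: "(\<Sum>k<Suc M. g k) \<le> 5 * sqrt (2 ^ Suc M / s)" .
      have "sqrt (2 ^ Suc M / s) \<le> sqrt 2" using True s by (simp add: field_simps)
      then have "(\<Sum>k<Suc M. g k) \<le> 8" using le sq2 by linarith
      moreover have "(s / 2 ^ Suc M)\<^sup>2 \<le> 1" if "2 ^ Suc M > s"
        using that s by (intro power_le_one) auto
      ultimately show ?thesis using le by auto
    next
      case False
      have "(\<Sum>k<Suc M. g k) \<le> 10 - 2 * y\<^sup>2 + y\<^sup>2"
        using Suc high[of M] False by (simp add: y_def)
      also have "\<dots> \<le> 10 - 2 * (y / 2)\<^sup>2" by (simp add: power_divide)
      finally show ?thesis using False by (simp add: y_def mult.commute)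
    qed
  qed
  then have "(\<Sum>k<M. g k) \<le> 5 * sqrt (2 ^ M / s) \<and> 2 ^ M \<le> s \<or> (\<Sum>k<M. g k) \<le> 10"
    using s by (smt (verit) zero_le_power2)
  moreover have "sqrt (2 ^ M / s) \<le> 1" if "2 ^ M \<le> s" using that s by simp
  ultimately show ?thesis by linarith
qed

text \<open>With \<open>s = n powr (1 / d)\<close>, the level at which cells hold about one point is \<open>2 ^ k = s\<close>, and the claimed order
is \<open>s ^ (d - 2)\<close>. Divided by it, the contribution of the level \<open>k\<close> is at most
\<open>2 * q powr (5 / 6 * d - 2)\<close> for \<open>q = 2 ^ k / s \<le> 1\<close>, where the exponent is at least \<open>1 / 2\<close>, and at
most \<open>1 / q\<^sup>2\<close> for \<open>q > 1\<close>, where the number of points is the better bound. The two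
regimes add up by \<open>two_sided_geometric_sum\<close>.\<close>

lemma multiscale_sum_le:
  fixes N :: "nat \<Rightarrow> ('d::finite \<Rightarrow> int) \<Rightarrow> nat"
  assumes d: "CARD('d) \<ge> 3" and n: "n \<ge> 1" and N: "\<And>k. (\<Sum>i\<in>grid k. N k i) = n"
  shows "(\<Sum>k<M. (\<Sum>i\<in>grid k. log_gauge (N k i)) / 4 ^ k)
     \<le> 10 * 72 ^ 12 * real n powr ((real CARD('d) - 2) / real CARD('d))"
proof -
  define d where "d = CARD('d)"
  define s where "s = real n powr (1 / real d)"
  have d3: "d \<ge> 3" using d by (simp add: d_def)
  have s: "s \<ge> 1" using n by (simp add: s_def ge_one_powr_ge_zero)
  have sd: "s ^ d = real n"
    using n d3 s by (simp add: s_def powr_realpow[symmetric] powr_powr)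
  have target: "real n powr ((real d - 2) / real d) = s ^ (d - 2)"
    using n d3 by (simp add: s_def powr_realpow[symmetric] powr_powr of_nat_diff)
  define S where "S k = (\<Sum>i\<in>grid k. real (N k i) powr (1 / 6))" for k
  have ne: "grid k \<noteq> ({} :: ('d \<Rightarrow> int) set)" for k
    using card_grid[of k, where 'd='d] by auto
  have cardP: "real (card (grid k :: ('d \<Rightarrow> int) set)) = (2 ^ k) ^ d" for k
    using card_grid[of k, where 'd='d] by (simp add: d_def power_mult)
  define g where "g k = S k / (4 ^ k * s ^ (d - 2))" for k
  have pow2: "z ^ d = z ^ (d - 2) * z\<^sup>2" for z :: real
  proof -
    have "d = (d - 2) + 2" using d3 by simp
    then show ?thesis by (metis power_add)
  qed
  have four: "(4::real) ^ k = (2 ^ k)\<^sup>2" for k by (simp add: power2_eq_square flip: power_mult_distrib)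
  have total: "(\<Sum>k<M. g k) \<le> 10"
  proof (rule two_sided_geometric_sum[OF s])
    fix k assume k: "2 ^ k \<le> s"
    define q where "q = 2 ^ k / s"
    have q: "0 < q" "q \<le> 1" using k s by (auto simp: q_def)
    have "S k \<le> 2 * (2 ^ k) ^ d * (real n / (2 ^ k) ^ d) powr (1 / 6)"
      using sum_powr_le(1)[OF finite_grid ne N n] by (simp add: S_def cardP)
    also have "real n / (2 ^ k) ^ d = (1 / q) ^ d"
      by (simp add: q_def sd[symmetric] power_divide)
    also have "\<dots> powr (1 / 6) = q powr (- (real d / 6))"
      using q by (simp add: powr_realpow[symmetric] powr_powr powr_divide powr_minus_divide)
    finally have "g k \<le> 2 * (2 ^ k) ^ d * q powr (- (real d / 6)) / (4 ^ k * s ^ (d - 2))"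
      unfolding g_def using s by (intro divide_right_mono) auto
    also have "\<dots> = 2 * (q ^ (d - 2) * q powr (- (real d / 6)))"
      unfolding pow2 four q_def using s by (simp add: power_divide)
    also have "q ^ (d - 2) * q powr (- (real d / 6)) = q powr (5 / 6 * real d - 2)"
      using q d3 by (simp add: powr_realpow[symmetric] of_nat_diff flip: powr_add)
    also have "\<dots> \<le> q powr (1 / 2)"
      using q d3 by (intro powr_mono') auto
    finally show "g k \<le> 2 * sqrt (2 ^ k / s)"
      using q by (simp add: powr_half_sqrt q_def)
  next
    fix k assume k: "2 ^ k > s"
    have "S k \<le> real n" unfolding S_def by (rule sum_powr_le(2)[OF finite_grid ne N n])
    then have "g k \<le> real n / (4 ^ k * s ^ (d - 2))"
      unfolding g_def using s by (intro divide_right_mono) auto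
    also have "\<dots> = (s / 2 ^ k)\<^sup>2"
      unfolding sd[symmetric] pow2 four using s by (simp add: power_divide)
    finally show "g k \<le> (s / 2 ^ k)\<^sup>2" .
  qed
  have g: "(\<Sum>k<M. S k / 4 ^ k) \<le> 10 * s ^ (d - 2)"
  proof -
    have "(\<Sum>k<M. g k) = (\<Sum>k<M. S k / 4 ^ k) / s ^ (d - 2)"
      unfolding g_def sum_divide_distrib by simp
    then show ?thesis using total s by (simp add: pos_divide_le_eq)
  qed
  have "(\<Sum>k<M. (\<Sum>i\<in>grid k. log_gauge (N k i)) / 4 ^ k) \<le> (\<Sum>k<M. 72 ^ 12 * S k / 4 ^ k)"
    unfolding S_def sum_distrib_left by (intro sum_mono divide_right_mono log_gauge_le) auto
  also have "\<dots> = 72 ^ 12 * (\<Sum>k<M. S k / 4 ^ k)" by (simp add: sum_distrib_left)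
  also have "\<dots> \<le> 72 ^ 12 * (10 * s ^ (d - 2))" using g by simp
  finally show ?thesis by (simp add: target[unfolded d_def] d_def)
qed

section \<open>Linear statistics as sums of increments\<close>

text \<open>The value at a cell is the average of the given values over its descendants \<open>m\<close> levels below. Averaging along
the tree, instead of integrating \<open>f\<close> over the cube, makes the increments have mean zero by construction.\<close>

fun tree_average :: "nat \<Rightarrow> (('d::finite \<Rightarrow> int) \<Rightarrow> real) \<Rightarrow> ('d \<Rightarrow> int) \<Rightarrow> real" where
  "tree_average 0 F i = F i"
| "tree_average (Suc m) F i = (\<Sum>c\<in>children i. tree_average m F c) / 2 ^ CARD('d)"

definition level_increment :: "nat \<Rightarrow> (('d::finite \<Rightarrow> int) \<Rightarrow> real) \<Rightarrow> nat \<Rightarrow> ('d \<Rightarrow> int) \<Rightarrow> real" where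
  "level_increment M F k c = tree_average (M - Suc k) F c - tree_average (M - k) F (parent c)"

lemma level_increment_mean_zero:
  fixes i :: "'d::finite \<Rightarrow> int"
  assumes "k < M"
  shows "(\<Sum>c\<in>children i. level_increment M F k c) = 0"
proof -
  have "(\<Sum>c\<in>children i. level_increment M F k c)
     = (\<Sum>c\<in>children i. tree_average (M - Suc k) F c - tree_average (M - k) F i)"
    by (intro sum.cong) (auto simp: level_increment_def children_def)
  also have "\<dots> = 0"
    using assms by (simp add: sum_subtractf card_children Suc_diff_Suc[symmetric])
  finally show ?thesis .
qed

lemma telescoping:
  assumes x: "x \<in> space (config {..<n})"
  shows "(\<Sum>j<n. F (cell M (x j))) - real n * tree_average M F (\<lambda>_. 0)
     = (\<Sum>(k, i)\<in>Sigma {..<M} grid. cell_increment n k (level_increment M F k) i x)"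
proof -
  have point: "F (cell M y) - tree_average M F (\<lambda>_. 0) = (\<Sum>k<M. level_increment M F k (cell (Suc k) y))"
    if "y \<in> half_open_cube" for y
  proof -
    have "(\<Sum>k<M. level_increment M F k (cell (Suc k) y))
      = (\<Sum>k<M. tree_average (M - Suc k) F (cell (Suc k) y) - tree_average (M - k) F (cell k y))"
      by (simp add: level_increment_def parent_cell)
    also have "\<dots> = tree_average (M - M) F (cell M y) - tree_average (M - 0) F (cell 0 y)"
      by (rule sum_lessThan_telescope)
    finally show ?thesis using that by (simp flip: cell_0_iff)
  qed
  have level: "(\<Sum>i\<in>grid k. cell_increment n k (level_increment M F k) i x)
     = (\<Sum>j<n. level_increment M F k (cell (Suc k) (x j)))" for k
    unfolding cell_increment_eq
    by (subst sum.swap, intro sum.cong refl)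
      (use cell_in_grid config_in_cube[OF x] in \<open>auto simp: sum.delta' finite_grid\<close>)
  have "(\<Sum>j<n. F (cell M (x j))) - real n * tree_average M F (\<lambda>_. 0)
     = (\<Sum>j<n. F (cell M (x j)) - tree_average M F (\<lambda>_. 0))"
    by (simp add: sum_subtractf)
  also have "\<dots> = (\<Sum>j<n. \<Sum>k<M. level_increment M F k (cell (Suc k) (x j)))"
    using config_in_cube[OF x] by (intro sum.cong refl point) auto
  also have "\<dots> = (\<Sum>k<M. \<Sum>i\<in>grid k. cell_increment n k (level_increment M F k) i x)"
    unfolding level by (rule sum.swap)
  also have "\<dots> = (\<Sum>(k, i)\<in>Sigma {..<M} grid. cell_increment n k (level_increment M F k) i x)"
    by (rule sum.Sigma) (auto simp: finite_grid)
  finally show ?thesis .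
qed

text \<open>Of any two different cells one is on a level at least as fine as the other, so \<open>increments_orthogonal\<close> applies to every
mixed term, possibly after exchanging the two.\<close>

lemma increments_pythagoras:
  fixes F :: "('d::finite \<Rightarrow> int) \<Rightarrow> real"
  assumes \<beta>: "\<beta> > 0"
  shows "(\<integral>x. (\<Sum>(k, i)\<in>Sigma {..<M} grid. cell_increment n k (level_increment M F k) i x)\<^sup>2 \<partial>hier_coulomb_gas n \<beta>)
    = (\<Sum>(k, i)\<in>Sigma {..<M} grid. \<integral>x. (cell_increment n k (level_increment M F k) i x)\<^sup>2 \<partial>hier_coulomb_gas n \<beta>)"
proof -
  let ?P = "Sigma {..<M} grid :: (nat \<times> ('d \<Rightarrow> int)) set" and ?M = "hier_coulomb_gas n \<beta>"
  define A where "A p = cell_increment n (fst p) (level_increment M F (fst p)) (snd p)" for p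
  have fin: "finite ?P" by (auto intro: finite_grid)
  have bd: "bounded_obs n (A p)" for p unfolding A_def by (rule bounded_obs_increment)
  have orth: "(\<integral>x. A p x * A q x \<partial>?M) = (if p = q then \<integral>x. (A p x)\<^sup>2 \<partial>?M else 0)"
    if "p \<in> ?P" "q \<in> ?P" for p q
  proof (cases "p = q")
    case True
    then show ?thesis by (simp add: power2_eq_square)
  next
    case False
    have *: "(\<integral>x. A p x * A q x \<partial>?M) = 0" if "p \<in> ?P" "fst q \<le> fst p" "p \<noteq> q" for p q
      unfolding A_def
      by (rule increments_orthogonal[OF \<beta>])
        (use that in \<open>auto intro!: level_increment_mean_zero simp: prod_eq_iff\<close>)
    show ?thesis
      using *[OF that(1)] *[OF that(2)] False
      by (cases "fst q \<le> fst p") (auto simp: mult.commute[of "A p _"])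
  qed
  have "(\<integral>x. (\<Sum>p\<in>?P. A p x)\<^sup>2 \<partial>?M) = (\<integral>x. (\<Sum>p\<in>?P. \<Sum>q\<in>?P. A p x * A q x) \<partial>?M)"
    by (simp add: power2_eq_square sum_product)
  also have "\<dots> = (\<Sum>p\<in>?P. \<Sum>q\<in>?P. \<integral>x. A p x * A q x \<partial>?M)"
    by (subst Bochner_Integration.integral_sum
        | intro sum.cong refl bounded_obs_integrable[OF \<beta>] bounded_obs_intros bd)+
  also have "\<dots> = (\<Sum>p\<in>?P. \<integral>x. (A p x)\<^sup>2 \<partial>?M)"
    using fin by (simp add: orth sum.delta' cong: sum.cong)
  finally show ?thesis by (simp add: A_def case_prod_beta)
qed

text \<open>An average of values of \<open>f\<close> at points of a cell inherits every bound that holds on the whole cell. The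
reference value \<open>v\<close> is kept fixed, since the points used for different children lie in different
children.\<close>

lemma tree_average_near:
  fixes f :: "real ^ 'd::finite \<Rightarrow> real"
  assumes "\<And>y. cell k y = i \<Longrightarrow> \<bar>f y - v\<bar> \<le> \<epsilon>"
  shows "\<bar>tree_average m (\<lambda>i. f (into_cell (k + m) i 0)) i - v\<bar> \<le> \<epsilon>"
  using assms
proof (induction m arbitrary: k i)
  case 0
  have "cell k (into_cell k i (0 :: real ^ 'd)) = i"
    by (rule cell_into_cell_same) (simp add: half_open_cube_def)
  then show ?case using 0 by simp
next
  case (Suc m)
  let ?t = "tree_average m (\<lambda>i. f (into_cell (k + Suc m) i 0))"
  have le: "\<bar>?t c - v\<bar> \<le> \<epsilon>" if "c \<in> children i" for c
  proof -
    have "\<bar>f y - v\<bar> \<le> \<epsilon>" if "cell (Suc k) y = c" for y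
      using Suc.prems[of y] parent_cell[of k y] that \<open>c \<in> children i\<close> by (simp add: children_def)
    from Suc.IH[of "Suc k" c, OF this] show ?thesis by simp
  qed
  have "tree_average (Suc m) (\<lambda>i. f (into_cell (k + Suc m) i 0)) i - v = (\<Sum>c\<in>children i. ?t c - v) / 2 ^ CARD('d)"
    by (simp add: sum_subtractf card_children diff_divide_distrib)
  also have "\<bar>\<dots>\<bar> \<le> (\<Sum>c\<in>children i. \<bar>?t c - v\<bar>) / 2 ^ CARD('d)"
    by (simp add: divide_right_mono)
  also have "\<dots> \<le> (\<Sum>c\<in>children i. \<epsilon>) / 2 ^ CARD('d)"
    by (intro divide_right_mono sum_mono le) auto
  also have "\<dots> = \<epsilon>" by (simp add: card_children)
  finally show ?case .
qed

lemma cell_diameter: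
  fixes x y :: "real ^ 'd::finite"
  assumes "cell k x = cell k y"
  shows "dist x y \<le> sqrt (real CARD('d)) / 2 ^ k"
proof -
  have comp: "\<bar>(x - y) $ l\<bar> \<le> 1 / 2 ^ k" for l
  proof -
    have "\<lfloor>2 ^ k * x $ l\<rfloor> = \<lfloor>2 ^ k * y $ l\<rfloor>" using assms by (simp add: cell_def fun_eq_iff)
    then have "\<bar>2 ^ k * x $ l - 2 ^ k * y $ l\<bar> \<le> 1" by linarith
    then have "2 ^ k * \<bar>x $ l - y $ l\<bar> \<le> 1" by (simp add: abs_mult flip: right_diff_distrib)
    then show ?thesis by (simp add: field_simps)
  qed
  have "dist x y = sqrt (\<Sum>l\<in>UNIV. ((x - y) $ l)\<^sup>2)"
    by (simp add: dist_norm norm_vec_def L2_set_def)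
  also have "\<dots> \<le> sqrt (\<Sum>l\<in>(UNIV :: 'd set). (1 / 2 ^ k)\<^sup>2)"
    using comp by (intro real_sqrt_le_mono sum_mono) (simp add: abs_le_square_iff[symmetric])
  also have "\<dots> = sqrt (real CARD('d)) / 2 ^ k"
    by (simp add: real_sqrt_mult real_sqrt_divide power_divide)
  finally show ?thesis .
qed

lemma lipschitz_on_cell:
  fixes f :: "real ^ 'd::finite \<Rightarrow> real"
  assumes "L-lipschitz_on closed_cube f" "cell k x = cell k y" "x \<in> half_open_cube" "y \<in> half_open_cube"
  shows "\<bar>f x - f y\<bar> \<le> L * sqrt (real CARD('d)) / 2 ^ k"
proof -
  have "half_open_cube \<subseteq> (closed_cube :: (real ^ 'd) set)"
    by (auto simp: half_open_cube_def closed_cube_def less_imp_le)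
  then have "dist (f x) (f y) \<le> L * dist x y"
    using assms(3,4) by (intro lipschitz_onD[OF assms(1)]) auto
  also have "\<dots> \<le> L * (sqrt (real CARD('d)) / 2 ^ k)"
    by (intro mult_left_mono cell_diameter assms lipschitz_on_nonneg[OF assms(1)])
  finally show ?thesis by (simp add: dist_real_def)
qed

lemma level_increment_le:
  fixes f :: "real ^ 'd::finite \<Rightarrow> real"
  assumes f: "L-lipschitz_on closed_cube f" and k: "k < M" and i: "i \<in> grid k" and c: "c \<in> children i"
  shows "\<bar>level_increment M (\<lambda>i. f (into_cell M i 0)) k c\<bar> \<le> 2 * L * sqrt (real CARD('d)) / 2 ^ k"
proof -
  define x :: "real ^ 'd" where "x = into_cell (Suc k) c 0"
  have "(0 :: real ^ 'd) \<in> half_open_cube" by (simp add: half_open_cube_def)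
  then have cx: "cell (Suc k) x = c" unfolding x_def by (rule cell_into_cell_same)
  then have ix: "cell k x = i" using parent_cell[of k x] c by (simp add: children_def)
  then have x: "x \<in> half_open_cube" using i by (simp flip: cell_in_grid_iff[of k])
  have near: "\<bar>tree_average (M - m) (\<lambda>i. f (into_cell M i 0)) (cell m x) - f x\<bar> \<le> L * sqrt (real CARD('d)) / 2 ^ m"
    if "m \<le> M" for m
  proof -
    have "\<bar>f y - f x\<bar> \<le> L * sqrt (real CARD('d)) / 2 ^ m" if "cell m y = cell m x" for y
    proof (rule lipschitz_on_cell[OF f that _ x])
      show "y \<in> half_open_cube" using that x cell_in_grid_iff[of m] by metis
    qed
    then show ?thesis using tree_average_near[of m "cell m x" f "f x" _ "M - m"] that by simp
  qed
  have L: "0 \<le> L * sqrt (real CARD('d))" using lipschitz_on_nonneg[OF f] by simp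
  have "L * sqrt (real CARD('d)) / 2 ^ Suc k \<le> L * sqrt (real CARD('d)) / 2 ^ k"
    by (intro divide_left_mono L power_increasing) auto
  then show ?thesis
    using near[of "Suc k"] near[of k] k c by (simp add: cx ix level_increment_def children_def)
qed

lemma bounded_obs_linear_statistic:
  fixes f :: "real ^ 'd::finite \<Rightarrow> real"
  assumes f: "L-lipschitz_on closed_cube f"
  shows "bounded_obs n (linear_statistic n f)"
proof -
  have sub: "half_open_cube \<subseteq> (closed_cube :: (real ^ 'd) set)"
    by (auto simp: half_open_cube_def closed_cube_def less_imp_le)
  have "continuous_on half_open_cube f"
    using lipschitz_on_continuous_on[OF f] sub continuous_on_subset by blast
  then have "f \<in> borel_measurable (restrict_space borel half_open_cube)"
    by (rule borel_measurable_continuous_on_restrict)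
  then have meas: "f \<in> borel_measurable cube_measure"
    unfolding cube_measure_def by (simp cong: measurable_cong_sets sets_restrict_space_cong)
  have zero: "(0 :: real ^ 'd) \<in> half_open_cube" by (simp add: half_open_cube_def)
  have pt: "bounded_obs n (\<lambda>x. f (x j))" if "j \<in> {..<n}" for j
    unfolding bounded_obs_def
  proof (intro conjI exI ballI)
    show "(\<lambda>x. f (x j)) \<in> borel_measurable (config {..<n})"
      using measurable_compose[of "\<lambda>x. x j" "config {..<n}" cube_measure f borel]
        measurable_component_singleton[of j "{..<n}" "\<lambda>_. cube_measure"] meas that by simp
    fix x :: "nat \<Rightarrow> real ^ 'd" assume x: "x \<in> space (config {..<n})"
    have "x j \<in> half_open_cube" using config_in_cube[OF x that] .
    moreover from this have "cell 0 (x j) = cell 0 0"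
      using zero by (simp add: cell_0_iff[THEN iffD2])
    ultimately show "\<bar>f (x j)\<bar> \<le> \<bar>f 0\<bar> + L * sqrt (real CARD('d)) / 2 ^ 0"
      using lipschitz_on_cell[OF f, of 0 "x j" 0] zero by simp
  qed
  show ?thesis unfolding linear_statistic_def by (intro bounded_obs_sum pt)
qed

lemma point_count_cell:
  "point_count n {x. cell k x = e} = (\<lambda>x. real (count_in n k e x))"
  by (simp add: point_count_def count_in_def fun_eq_iff)

text \<open>The constant collects: 2 for splitting the square of the sum of error and increments, \<open>4 ^ d\<close> from
\<open>top_increment_second_moment\<close>, \<open>4 * L\<^sup>2 * d\<close> from the squared coefficients, and \<open>10 * 72 ^ 12\<close> from
\<open>multiscale_sum_le\<close>. The bound is obtained for each depth \<open>M\<close> with an error that vanishes as \<open>M\<close> grows.\<close>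

lemma linear_statistic_variance:
  fixes f :: "real ^ 'd::finite \<Rightarrow> real"
  assumes d: "CARD('d) \<ge> 3" and \<beta>: "\<beta> > 0" and f: "L-lipschitz_on closed_cube f" and n: "n \<ge> 1"
    and \<kappa>: "\<kappa> \<ge> 0"
    and var: "\<And>m \<beta>' (e :: 'd \<Rightarrow> int). m \<ge> 1 \<Longrightarrow> \<beta>' \<ge> \<beta> \<Longrightarrow> e \<in> grid 1 \<Longrightarrow>
        prob_space.variance (hier_coulomb_gas m \<beta>') (\<lambda>x. real (count_in m 1 e x)) \<le> \<kappa> * log_gauge m"
  shows "prob_space.variance (hier_coulomb_gas n \<beta>) (linear_statistic n f)
    \<le> 80 * 72 ^ 12 * 4 ^ CARD('d) * real CARD('d) * \<kappa> * L\<^sup>2 * real n powr ((real CARD('d) - 2) / real CARD('d))"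
proof -
  let ?M = "hier_coulomb_gas n \<beta> :: (nat \<Rightarrow> real ^ 'd) measure" and ?X = "linear_statistic n f"
  interpret prob_space ?M by (rule prob_space_gas[OF \<beta>])
  note int = bounded_obs_integrable[OF \<beta>]
  have X: "bounded_obs n ?X" by (rule bounded_obs_linear_statistic[OF f])
  define V where "V = 4 ^ CARD('d) * (4 * L\<^sup>2 * real CARD('d)) * \<kappa> * (10 * 72 ^ 12 * real n powr ((real CARD('d) - 2) / real CARD('d)))"
  define err where "err M = real n * (L * sqrt (real CARD('d)) / 2 ^ M)" for M :: nat
  have main: "variance ?X \<le> 2 * (err M)\<^sup>2 + 2 * V" for M
  proof -
    define F where "F i = f (into_cell M i 0)" for i
    define c where "c = real n * tree_average M F (\<lambda>_. 0)"
    define Y where "Y x = (\<Sum>(k, i)\<in>Sigma {..<M} grid. cell_increment n k (level_increment M F k) i x)" for x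
    have Y_bd: "bounded_obs n Y"
      unfolding Y_def case_prod_beta by (intro bounded_obs_sum bounded_obs_increment)
    have close: "\<bar>?X x - c - Y x\<bar> \<le> err M" if x: "x \<in> space (config {..<n})" for x
    proof -
      have "\<bar>f (x j) - F (cell M (x j))\<bar> \<le> L * sqrt (real CARD('d)) / 2 ^ M" if "j < n" for j
      proof -
        have xj: "x j \<in> half_open_cube" using config_in_cube[OF x] that by simp
        have "(0 :: real ^ 'd) \<in> half_open_cube" by (simp add: half_open_cube_def)
        then have e: "cell M (into_cell M (cell M (x j)) 0) = cell M (x j)" by (rule cell_into_cell_same)
        show ?thesis unfolding F_def
        proof (rule lipschitz_on_cell[OF f e[symmetric] xj])
          show "into_cell M (cell M (x j)) 0 \<in> half_open_cube"
            using e xj cell_in_grid_iff[of M] by metis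
        qed
      qed
      then have "(\<Sum>j<n. \<bar>f (x j) - F (cell M (x j))\<bar>) \<le> (\<Sum>j<n. L * sqrt (real CARD('d)) / 2 ^ M)"
        by (intro sum_mono) auto
      moreover have "?X x - c - Y x = (\<Sum>j<n. f (x j) - F (cell M (x j)))"
        unfolding Y_def telescoping[OF x, symmetric] c_def linear_statistic_def by (simp add: sum_subtractf)
      ultimately show ?thesis
        by (auto simp: err_def intro: order_trans[OF sum_abs])
    qed
    have incr: "(\<integral>x. (cell_increment n k (level_increment M F k) i x)\<^sup>2 \<partial>?M)
      \<le> 4 ^ CARD('d) * (4 * L\<^sup>2 * real CARD('d)) * \<kappa> * (\<integral>x. log_gauge (count_in n k i x) / 4 ^ k \<partial>?M)"
      if "k < M" "i \<in> grid k" for k i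
    proof -
      have "(\<integral>x. (cell_increment n k (level_increment M F k) i x)\<^sup>2 \<partial>?M)
        \<le> 4 ^ CARD('d) * (2 * L * sqrt (real CARD('d)) / 2 ^ k)\<^sup>2 * \<kappa> * (\<integral>x. log_gauge (count_in n k i x) \<partial>?M)"
        unfolding F_def
        by (rule increment_second_moment[OF \<beta> that(2) level_increment_mean_zero[OF that(1)]
              level_increment_le[OF f that] _ log_gauge_nonneg \<kappa> var]) (auto simp: log_gauge_def)
      also have "(2 * L * sqrt (real CARD('d)) / 2 ^ k)\<^sup>2 = 4 * L\<^sup>2 * real CARD('d) / 4 ^ k"
      proof -
        have "((2::real) ^ k)\<^sup>2 = 4 ^ k"
          by (simp add: power2_eq_square flip: power_mult_distrib)
        then show ?thesis by (simp add: power_divide power_mult_distrib)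
      qed
      finally show ?thesis by simp
    qed
    have "(\<integral>x. (Y x)\<^sup>2 \<partial>?M) \<le> (\<Sum>(k, i)\<in>Sigma {..<M} grid.
        4 ^ CARD('d) * (4 * L\<^sup>2 * real CARD('d)) * \<kappa> * (\<integral>x. log_gauge (count_in n k i x) / 4 ^ k \<partial>?M))"
      unfolding Y_def increments_pythagoras[OF \<beta>] by (intro sum_mono) (use incr in auto)
    also have "\<dots> = 4 ^ CARD('d) * (4 * L\<^sup>2 * real CARD('d)) * \<kappa> *
        (\<integral>x. (\<Sum>(k, i)\<in>Sigma {..<M} grid. log_gauge (count_in n k i x) / 4 ^ k) \<partial>?M)"
      by (subst Bochner_Integration.integral_sum)
        (auto simp: sum_distrib_left case_prod_beta intro!: int bounded_obs_fun_count[of n "\<lambda>m. log_gauge m / _"])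
    also have "(\<integral>x. (\<Sum>(k, i)\<in>Sigma {..<M} grid. log_gauge (count_in n k i x) / 4 ^ k) \<partial>?M)
        \<le> (\<integral>x. 10 * 72 ^ 12 * real n powr ((real CARD('d) - 2) / real CARD('d)) \<partial>?M)"
    proof (intro integral_mono int)
      show "bounded_obs n (\<lambda>x. \<Sum>(k, i)\<in>Sigma {..<M} grid. log_gauge (count_in n k i x) / 4 ^ k)"
        unfolding case_prod_beta by (intro bounded_obs_sum bounded_obs_fun_count[of n "\<lambda>m. log_gauge m / _"])
      fix x assume "x \<in> space ?M"
      then have x: "x \<in> space (config {..<n})" by (simp add: space_gas)
      have total: "(\<Sum>i\<in>grid k. count_in n k i x) = n" for k
      proof -
        have "(\<Sum>i\<in>grid k. 1 * real (count_in n k i x)) = (\<Sum>j<n. if True then 1 else 0)"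
          by (rule sum_over_cells) (auto simp: finite_grid intro!: cell_in_grid config_in_cube[OF x])
        then show ?thesis by (simp flip: of_nat_sum)
      qed
      have "(\<Sum>(k, i)\<in>Sigma {..<M} grid. log_gauge (count_in n k i x) / 4 ^ k)
        = (\<Sum>k<M. (\<Sum>i\<in>grid k. log_gauge (count_in n k i x)) / 4 ^ k)"
        by (subst sum.Sigma[symmetric]) (auto simp: finite_grid sum_divide_distrib)
      also have "\<dots> \<le> 10 * 72 ^ 12 * real n powr ((real CARD('d) - 2) / real CARD('d))"
        by (rule multiscale_sum_le[OF d n total])
      finally show "(\<Sum>(k, i)\<in>Sigma {..<M} grid. log_gauge (count_in n k i x) / 4 ^ k)
        \<le> 10 * 72 ^ 12 * real n powr ((real CARD('d) - 2) / real CARD('d))" .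
    qed (rule bounded_obs_const)
    finally have YV: "(\<integral>x. (Y x)\<^sup>2 \<partial>?M) \<le> V"
      using \<kappa> by (simp add: V_def mult_left_mono prob_space)
    have "variance ?X \<le> (\<integral>x. (?X x - c)\<^sup>2 \<partial>?M)"
    proof -
      have i1: "integrable ?M (\<lambda>x. ?X x - c)" and i2: "integrable ?M (\<lambda>x. (?X x - c)\<^sup>2)"
        by (intro int bounded_obs_intros X)+
      \<comment> \<open>the mean minimises the second moment about a point, so any centre \<open>c\<close> may be used\<close>
      have "variance (\<lambda>x. ?X x - c) = variance ?X"
        using int[OF X] by (simp add: prob_space)
      then show ?thesis
        using variance_eq[OF i1 i2] zero_le_power2[of "expectation (\<lambda>x. ?X x - c)"] by linarith
    qed
    also have "\<dots> \<le> (\<integral>x. 2 * (err M)\<^sup>2 + 2 * (Y x)\<^sup>2 \<partial>?M)"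
    proof (intro integral_mono int bounded_obs_intros X Y_bd)
      fix x assume "x \<in> space ?M"
      then have "\<bar>?X x - c - Y x\<bar> \<le> err M" by (intro close) (simp add: space_gas)
      then have le: "(?X x - c - Y x)\<^sup>2 \<le> (err M)\<^sup>2" by (simp add: abs_le_square_iff[symmetric])
      have "(?X x - c)\<^sup>2 \<le> 2 * (?X x - c - Y x)\<^sup>2 + 2 * (Y x)\<^sup>2"
        using zero_le_power2[of "?X x - c - 2 * Y x"] by (simp add: power2_eq_square algebra_simps)
      then show "(?X x - c)\<^sup>2 \<le> 2 * (err M)\<^sup>2 + 2 * (Y x)\<^sup>2" using le by linarith
    qed
    also have "\<dots> = 2 * (err M)\<^sup>2 + 2 * (\<integral>x. (Y x)\<^sup>2 \<partial>?M)"
      using int[OF bounded_obs_power2[OF Y_bd]] by (simp add: prob_space)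
    also have "\<dots> \<le> 2 * (err M)\<^sup>2 + 2 * V" using YV by simp
    finally show ?thesis .
  qed
  have "err \<longlonglongrightarrow> real n * 0"
    unfolding err_def by (intro tendsto_mult tendsto_const LIMSEQ_divide_realpow_zero) simp
  then have "(\<lambda>M. 2 * (err M)\<^sup>2 + 2 * V) \<longlonglongrightarrow> 2 * 0\<^sup>2 + 2 * V"
    by (intro tendsto_intros) simp
  then have "variance ?X \<le> 2 * 0\<^sup>2 + 2 * V"
    by (rule LIMSEQ_le_const) (use main in blast)
  then show ?thesis by (simp add: V_def mult_ac)
qed

theorem theorem5:
  assumes "CARD('d::finite) \<ge> 3"
  shows "\<exists>C :: real. \<forall>K :: real \<Rightarrow> real.
    antimono_on {0<..} K \<longrightarrow>
    (\<forall>n \<ge> 1. \<forall>\<beta> > 0. \<forall>D \<in> (dyadic_cubes 1 :: (real ^ 'd) set set).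
       prob_space.variance (hier_coulomb_gas n \<beta>) (point_count n D)
         \<le> K \<beta> * max (ln (real n) ^ 12) 1) \<longrightarrow>
    (\<forall>\<beta> > 0. \<forall>L. \<forall>f :: real ^ 'd \<Rightarrow> real. L-lipschitz_on closed_cube f \<longrightarrow>
       (\<forall>n \<ge> 1.
          prob_space.variance (hier_coulomb_gas n \<beta>) (linear_statistic n f)
            \<le> C * K \<beta> * L\<^sup>2 * real n powr ((real CARD('d) - 2) / real CARD('d))))"
proof (intro exI allI impI)
  fix K :: "real \<Rightarrow> real" and \<beta> L :: real and f :: "real ^ 'd \<Rightarrow> real" and n :: nat
  assume anti: "antimono_on {0<..} K" and \<beta>: "\<beta> > 0" and f: "L-lipschitz_on closed_cube f" and n: "n \<ge> 1"
  assume "\<forall>n \<ge> 1. \<forall>\<beta> > 0. \<forall>D \<in> (dyadic_cubes 1 :: (real ^ 'd) set set).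
       prob_space.variance (hier_coulomb_gas n \<beta>) (point_count n D) \<le> K \<beta> * max (ln (real n) ^ 12) 1"
  note count_var = this[rule_format]
  have var: "prob_space.variance (hier_coulomb_gas m \<beta>') (\<lambda>x. real (count_in m 1 e x)) \<le> K \<beta>' * log_gauge m"
    if "m \<ge> 1" "\<beta>' > 0" "e \<in> grid 1" for m \<beta>' and e :: "'d \<Rightarrow> int"
  proof -
    have "{x. cell 1 x = e} \<in> dyadic_cubes 1" using that(3) by (auto simp: dyadic_cubes_eq)
    from count_var[OF that(1,2) this] show ?thesis
      using that(1) by (simp add: point_count_cell log_gauge_def)
  qed
  have mono: "K \<beta>' \<le> K \<beta>" if "\<beta>' \<ge> \<beta>" for \<beta>'
    using anti \<beta> that by (auto simp: monotone_on_def)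
  \<comment> \<open>the bound for a single point, where the gauge is one\<close>
  have nonneg: "K \<beta> \<ge> 0"
  proof -
    interpret prob_space "hier_coulomb_gas 1 \<beta> :: (nat \<Rightarrow> real ^ 'd) measure"
      by (rule prob_space_gas[OF \<beta>])
    have "(\<lambda>_. 0) \<in> (grid 1 :: ('d \<Rightarrow> int) set)" by (simp add: grid_def)
    from order_trans[OF variance_positive var[OF order_refl \<beta> this]]
    show ?thesis by (simp add: log_gauge_def)
  qed
  show "prob_space.variance (hier_coulomb_gas n \<beta>) (linear_statistic n f)
      \<le> (80 * 72 ^ 12 * 4 ^ CARD('d) * real CARD('d)) * K \<beta> * L\<^sup>2 * real n powr ((real CARD('d) - 2) / real CARD('d))"
  proof (rule linear_statistic_variance[OF assms \<beta> f n nonneg])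
    fix m :: nat and \<beta>' :: real and e :: "'d \<Rightarrow> int"
    assume *: "m \<ge> 1" "\<beta>' \<ge> \<beta>" "e \<in> grid 1"
    have "prob_space.variance (hier_coulomb_gas m \<beta>') (\<lambda>x. real (count_in m 1 e x)) \<le> K \<beta>' * log_gauge m"
      using * \<beta> by (intro var) auto
    also have "\<dots> \<le> K \<beta> * log_gauge m"
      using * by (intro mult_right_mono mono log_gauge_nonneg)
    finally show "prob_space.variance (hier_coulomb_gas m \<beta>') (\<lambda>x. real (count_in m 1 e x)) \<le> K \<beta> * log_gauge m" .
  qed
qed

end
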